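(* The dual operad $\mathcal{L}ieAdm^{!}$ of the Lie-admissible operad $\mathcal{L}ieAdm$ is the binary quadratic operad whose corresponding algebras are the associative algebras satisfying $$abc=acb=bac$$ for all elements $a,b,c$, that is, the associative algebras which are 3-order abelian.
   Context: $\mathbb{K}$ is a commutative field of characteristic zero and $\Sigma_n$ is the symmetric group of degree $n$. Let $E=\mathbb{K}[\Sigma_2]$ and let $\mathcal{F}(E)$ be the free operad generated by $E$ (one binary operation $x_1.x_2$ without symmetry). A basis of the 12-dimensional space $\mathcal{F}(E)(3)$ is given by the monomials $(x_i.x_j).x_k$ and $x_i.(x_j.x_k)$ with $\{i,j,k\}=\{1,2,3\}$. For a $\mathbb{K}[\Sigma_3]$-submodule $R\subset\mathcal{F}(E)(3)$, let $\mathcal{R}$ be the operadic ideal of $\mathcal{F}(E)$ generated by $R$; the binary quadratic operad generated by $E$ and $R$ is $\mathcal{F}(E)/\mathcal{R}$, whose algebras are vector spaces with a bilinear product satisfying the relations in $R$. The operad $\mathcal{L}ieAdm$ is $\mathcal{F}(E)/\mathcal{R}$ with $R$ the $\mathbb{K}[\Sigma_3]$-submodule generated by $$u=\sum_{\sigma\in\Sigma_3}\mathrm{sgn}(\sigma)\big(x_{\sigma(1)}.(x_{\sigma(2)}.x_{\sigma(3)})-(x_{\sigma(1)}.x_{\sigma(2)}).x_{\sigma(3)}\big).$$ The dual operad of a binary quadratic operad $\mathcal{P}=\mathcal{P}(\mathbb{K},E,R)$ is $\mathcal{P}^!=\mathcal{P}(\mathbb{K},E^\vee,R^\perp)$ (Koszul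 dual operad in the sense of Ginzburg–Kapranov), where $E^\vee$ is the dual of $E$ tensored with the signature and $R^\perp$ is the orthogonal of $R$ in $\mathcal{F}(E^\vee)(3)=\mathcal{F}(E)(3)^\vee$. For $E=\mathbb{K}[\Sigma_2]$ this is $\mathcal{F}(E)/\mathcal{R}^\perp$, with $\mathcal{R}^\perp$ the ideal generated by the orthogonal $R^\perp$ of $R$ for the bilinear form on $\mathcal{F}(E)(3)$ for which distinct basis monomials are orthogonal and, with $s=\mathrm{sgn}\begin{pmatrix}1&2&3\\ i&j&k\end{pmatrix}$, $\langle x_i.(x_j.x_k),x_i.(x_j.x_k)\rangle=s$ and $\langle (x_i.x_j).x_k,(x_i.x_j).x_k\rangle=-s$. An associative algebra $A$ is called 3-order abelian if $X_1X_2X_3=X_{\sigma(1)}X_{\sigma(2)}X_{\sigma(3)}$ for all $\sigma\in\Sigma_3$ and all $X_1,X_2,X_3\in A$. Algebras are not assumed unital. *)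

theory Defs
  imports Complex_Main "HOL-Combinatorics.Permutations" "HOL-Library.FuncSet" "HOL-Library.Function_Algebras"
begin

section \<open>Linear symmetric operads\<close>

text \<open>
  The data of a \<open>'k\<close>-linear symmetric operad, in terms of partial compositions. All arguments of
  type \<^typ>\<open>nat\<close> are arities, except the third one of \<open>comp_op\<close>: \<open>comp_op P m n i f g\<close> is
  \<open>f \<circ>\<^sub>i g\<close> for \<open>f\<close> of arity \<open>m\<close>, \<open>g\<close> of arity \<open>n\<close> and \<open>1 \<le> i \<le> m\<close>; it has arity \<open>m + n - 1\<close>.
  The symmetric group of degree \<open>n\<close> consists of the maps permuting \<open>{1..n}\<close>, and it acts on the left.
\<close>

record ('k, 'a) operad =
  ops :: "nat \<Rightarrow> 'a set"
  zero_op :: "nat \<Rightarrow> 'a"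
  add_op :: "nat \<Rightarrow> 'a \<Rightarrow> 'a \<Rightarrow> 'a"
  scale_op :: "nat \<Rightarrow> 'k \<Rightarrow> 'a \<Rightarrow> 'a"
  perm_op :: "nat \<Rightarrow> (nat \<Rightarrow> nat) \<Rightarrow> 'a \<Rightarrow> 'a"
  comp_op :: "nat \<Rightarrow> nat \<Rightarrow> nat \<Rightarrow> 'a \<Rightarrow> 'a \<Rightarrow> 'a"
  unit_op :: 'a

definition operad_homs :: "('k, 'a) operad \<Rightarrow> ('k, 'b) operad \<Rightarrow> (nat \<Rightarrow> 'a \<Rightarrow> 'b) set" where
  "operad_homs P Q = {\<phi>.
     (\<forall>n. \<phi> n \<in> ops P n \<rightarrow>\<^sub>E ops Q n) \<and>
     (\<forall>n. \<forall>f\<in>ops P n. \<forall>g\<in>ops P n. \<phi> n (add_op P n f g) = add_op Q n (\<phi> n f) (\<phi> n g)) \<and>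
     (\<forall>n c. \<forall>f\<in>ops P n. \<phi> n (scale_op P n c f) = scale_op Q n c (\<phi> n f)) \<and>
     (\<forall>n \<sigma>. \<sigma> permutes {1..n} \<longrightarrow>
        (\<forall>f\<in>ops P n. \<phi> n (perm_op P n \<sigma> f) = perm_op Q n \<sigma> (\<phi> n f))) \<and>
     (\<forall>m n. \<forall>i\<in>{1..m}. \<forall>f\<in>ops P m. \<forall>g\<in>ops P n.
        \<phi> (m + n - 1) (comp_op P m n i f g) = comp_op Q m n i (\<phi> m f) (\<phi> n g)) \<and>
     \<phi> 1 (unit_op P) = unit_op Q}"

definition operadic_ideal :: "('k, 'a) operad \<Rightarrow> (nat \<Rightarrow> 'a set) \<Rightarrow> bool" where
  "operadic_ideal P I \<longleftrightarrow>
     (\<forall>n. I n \<subseteq> ops P n) \<and>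
     (\<forall>n. zero_op P n \<in> I n) \<and>
     (\<forall>n. \<forall>f\<in>I n. \<forall>g\<in>I n. add_op P n f g \<in> I n) \<and>
     (\<forall>n c. \<forall>f\<in>I n. scale_op P n c f \<in> I n) \<and>
     (\<forall>n \<sigma>. \<sigma> permutes {1..n} \<longrightarrow> (\<forall>f\<in>I n. perm_op P n \<sigma> f \<in> I n)) \<and>
     (\<forall>m n. \<forall>i\<in>{1..m}. \<forall>f\<in>I m. \<forall>g\<in>ops P n. comp_op P m n i f g \<in> I (m + n - 1)) \<and>
     (\<forall>m n. \<forall>i\<in>{1..m}. \<forall>f\<in>ops P m. \<forall>g\<in>I n. comp_op P m n i f g \<in> I (m + n - 1))"

definition generated_ideal :: "('k, 'a) operad \<Rightarrow> (nat \<Rightarrow> 'a set) \<Rightarrow> nat \<Rightarrow> 'a set" where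
  "generated_ideal P X = Inf {I. operadic_ideal P I \<and> X \<le> I}"

definition op_coset :: "('k, 'a) operad \<Rightarrow> (nat \<Rightarrow> 'a set) \<Rightarrow> nat \<Rightarrow> 'a \<Rightarrow> 'a set" where
  "op_coset P I n f = add_op P n f ` I n"

definition quotient_operad :: "('k, 'a) operad \<Rightarrow> (nat \<Rightarrow> 'a set) \<Rightarrow> ('k, 'a set) operad" where
  "quotient_operad P I =
    \<lparr>ops = (\<lambda>n. op_coset P I n ` ops P n),
     zero_op = (\<lambda>n. op_coset P I n (zero_op P n)),
     add_op = (\<lambda>n A B. \<Union>f\<in>A. \<Union>g\<in>B. op_coset P I n (add_op P n f g)),
     scale_op = (\<lambda>n c A. \<Union>f\<in>A. op_coset P I n (scale_op P n c f)),
     perm_op = (\<lambda>n \<sigma> A. \<Union>f\<in>A. op_coset P I n (perm_op P n \<sigma> f)),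
     comp_op = (\<lambda>m n i A B. \<Union>f\<in>A. \<Union>g\<in>B. op_coset P I (m + n - 1) (comp_op P m n i f g)),
     unit_op = op_coset P I 1 (unit_op P)\<rparr>"


section \<open>Algebras over an operad\<close>

text \<open>
  An \<open>n\<close>-ary multilinear operation is a function of \<open>x\<close> that depends only on \<open>x 1, \<dots>, x n\<close>.
\<close>

definition multilinear_ops ::
    "('k::field \<Rightarrow> 'v::ab_group_add \<Rightarrow> 'v) \<Rightarrow> nat \<Rightarrow> ((nat \<Rightarrow> 'v) \<Rightarrow> 'v) set" where
  "multilinear_ops scale n = {f.
     (\<forall>x y. (\<forall>i\<in>{1..n}. x i = y i) \<longrightarrow> f x = f y) \<and>
     (\<forall>i\<in>{1..n}. \<forall>x. Vector_Spaces.linear scale scale (\<lambda>v. f (x(i := v))))}"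

definition End_operad ::
    "('k::field \<Rightarrow> 'v::ab_group_add \<Rightarrow> 'v) \<Rightarrow> ('k, (nat \<Rightarrow> 'v) \<Rightarrow> 'v) operad" where
  "End_operad scale =
    \<lparr>ops = multilinear_ops scale,
     zero_op = (\<lambda>n x. 0),
     add_op = (\<lambda>n f g x. f x + g x),
     scale_op = (\<lambda>n c f x. scale c (f x)),
     perm_op = (\<lambda>n \<sigma> f x. f (\<lambda>j. x (\<sigma> j))),
     comp_op = (\<lambda>m n i f g x.
       f (\<lambda>j. if j < i then x j else if j = i then g (\<lambda>l. x (l + i - 1)) else x (j + n - 1))),
     unit_op = (\<lambda>x. x 1)\<rparr>"

definition algebra_structures ::
    "('k::field \<Rightarrow> 'v::ab_group_add \<Rightarrow> 'v) \<Rightarrow> ('k, 'a) operad \<Rightarrow> (nat \<Rightarrow> 'a \<Rightarrow> (nat \<Rightarrow> 'v) \<Rightarrow> 'v) set"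
  where "algebra_structures scale P = operad_homs P (End_operad scale)"


section \<open>The free operad on one binary operation without symmetry\<close>

datatype 'a monomial = Gen 'a | Prod "'a monomial" "'a monomial" (infixl "\<odot>" 70)

primrec leaves :: "'a monomial \<Rightarrow> 'a list" where
  "leaves (Gen a) = [a]"
| "leaves (s \<odot> t) = leaves s @ leaves t"

primrec subst :: "('a \<Rightarrow> 'b monomial) \<Rightarrow> 'a monomial \<Rightarrow> 'b monomial" where
  "subst \<theta> (Gen a) = \<theta> a"
| "subst \<theta> (s \<odot> t) = subst \<theta> s \<odot> subst \<theta> t"

definition monomials :: "nat \<Rightarrow> nat monomial set" where
  "monomials n = {t. distinct (leaves t) \<and> set (leaves t) = {1..n}}"

definition graft :: "nat \<Rightarrow> nat \<Rightarrow> nat monomial \<Rightarrow> nat monomial \<Rightarrow> nat monomial" where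
  "graft n i s t =
     subst (\<lambda>j. if j < i then Gen j
                else if j = i then map_monomial (\<lambda>l. l + i - 1) t
                else Gen (j + n - 1)) s"

text \<open>
  Linear combinations of monomials are represented by their coefficient functions. The space of
  arity \<open>n\<close> consists of the functions vanishing outside the finite set \<^term>\<open>monomials n\<close>.
\<close>

type_synonym 'k comb = "nat monomial \<Rightarrow> 'k"

definition cscale :: "'k::field \<Rightarrow> 'k comb \<Rightarrow> 'k comb" where
  "cscale c f = (\<lambda>t. c * f t)"

definition monom_of :: "nat monomial \<Rightarrow> 'k::field comb" where
  "monom_of t = (\<lambda>t'. if t' = t then 1 else 0)"

definition free_space :: "nat \<Rightarrow> 'k::field comb set" where
  "free_space n = {f. \<forall>t. t \<notin> monomials n \<longrightarrow> f t = 0}"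

definition free_operad :: "('k::field, 'k comb) operad" where
  "free_operad =
    \<lparr>ops = free_space,
     zero_op = (\<lambda>n. 0),
     add_op = (\<lambda>n. (+)),
     scale_op = (\<lambda>n. cscale),
     perm_op = (\<lambda>n \<sigma> f. \<Sum>t\<in>monomials n. cscale (f t) (monom_of (map_monomial \<sigma> t))),
     comp_op = (\<lambda>m n i f g.
       \<Sum>s\<in>monomials m. \<Sum>t\<in>monomials n. cscale (f s * g t) (monom_of (graft n i s t))),
     unit_op = monom_of (Gen 1)\<rparr>"


section \<open>Binary quadratic operads and their duals\<close>

definition sigma3_submodule :: "'k::field comb set \<Rightarrow> bool" where
  "sigma3_submodule R \<longleftrightarrow>
     R \<subseteq> free_space 3 \<and> module.subspace cscale R \<and>
     (\<forall>\<sigma>. \<sigma> permutes {1..3} \<longrightarrow> (\<forall>f\<in>R. perm_op free_operad 3 \<sigma> f \<in> R))"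

definition relation_ideal :: "'k::field comb set \<Rightarrow> nat \<Rightarrow> 'k comb set" where
  "relation_ideal R = generated_ideal free_operad (\<lambda>n. if n = 3 then R else {})"

definition binary_quadratic_operad :: "'k::field comb set \<Rightarrow> ('k, 'k comb set) operad" where
  "binary_quadratic_operad R = quotient_operad free_operad (relation_ideal R)"

text \<open>
  The product of an algebra over \<^term>\<open>binary_quadratic_operad R\<close>, i.e. the operation by which the
  class of \<open>x\<^sub>1.x\<^sub>2\<close> acts.
\<close>

definition algebra_product ::
    "'k::field comb set \<Rightarrow> (nat \<Rightarrow> 'k comb set \<Rightarrow> (nat \<Rightarrow> 'v) \<Rightarrow> 'v) \<Rightarrow> 'v \<Rightarrow> 'v \<Rightarrow> 'v" where
  "algebra_product R \<phi> a b =
     \<phi> 2 (op_coset free_operad (relation_ideal R) 2 (monom_of (Gen 1 \<odot> Gen 2)))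
         (\<lambda>j. if j = 1 then a else b)"

definition perm3 :: "nat \<Rightarrow> nat \<Rightarrow> nat \<Rightarrow> nat \<Rightarrow> nat" where
  "perm3 i j k = id(1 := i, 2 := j, 3 := k)"

fun pairing_sign :: "nat monomial \<Rightarrow> int" where
  "pairing_sign (Gen i \<odot> (Gen j \<odot> Gen k)) = sign (perm3 i j k)"
| "pairing_sign (Gen i \<odot> Gen j \<odot> Gen k) = - sign (perm3 i j k)"
| "pairing_sign _ = 0"

definition pairing :: "'k::field comb \<Rightarrow> 'k comb \<Rightarrow> 'k" where
  "pairing f g = (\<Sum>t\<in>monomials 3. of_int (pairing_sign t) * f t * g t)"

definition orthogonal_relations :: "'k::field comb set \<Rightarrow> 'k comb set" where
  "orthogonal_relations R = {g \<in> free_space 3. \<forall>f\<in>R. pairing f g = 0}"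

text \<open>
  The dual of the operad presented by \<open>R\<close>. For the regular representation of the symmetric group of
  degree 2 as generators, the sign-twisted dual of the generators is identified with the generators;
  \<^const>\<open>pairing\<close> is the resulting bilinear form in arity 3.
\<close>

definition dual_operad :: "'k::field comb set \<Rightarrow> ('k, 'k comb set) operad" where
  "dual_operad R = binary_quadratic_operad (orthogonal_relations R)"


section \<open>Lie-admissible and 3-order abelian associative algebras\<close>

definition lie_adm_element :: "'k::field comb" where
  "lie_adm_element =
     (\<Sum>\<sigma> | \<sigma> permutes {1..3}. cscale (of_int (sign \<sigma>))
        (monom_of (Gen (\<sigma> 1) \<odot> (Gen (\<sigma> 2) \<odot> Gen (\<sigma> 3))) - monom_of (Gen (\<sigma> 1) \<odot> Gen (\<sigma> 2) \<odot> Gen (\<sigma> 3))))"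

definition lie_adm_relations :: "'k::field comb set" where
  "lie_adm_relations = sigma3_submodule hull {lie_adm_element}"

definition assoc_abelian_relations :: "'k::field comb set" where
  "assoc_abelian_relations = sigma3_submodule hull
     {monom_of (Gen 1 \<odot> Gen 2 \<odot> Gen 3) - monom_of (Gen 1 \<odot> (Gen 2 \<odot> Gen 3)),
      monom_of (Gen 1 \<odot> Gen 2 \<odot> Gen 3) - monom_of (Gen 1 \<odot> Gen 3 \<odot> Gen 2),
      monom_of (Gen 1 \<odot> Gen 2 \<odot> Gen 3) - monom_of (Gen 2 \<odot> Gen 1 \<odot> Gen 3)}"

definition bilinear_product ::
    "('k::field \<Rightarrow> 'v::ab_group_add \<Rightarrow> 'v) \<Rightarrow> ('v \<Rightarrow> 'v \<Rightarrow> 'v) \<Rightarrow> bool" where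
  "bilinear_product scale p \<longleftrightarrow>
     (\<forall>a. Vector_Spaces.linear scale scale (\<lambda>b. p a b)) \<and>
     (\<forall>b. Vector_Spaces.linear scale scale (\<lambda>a. p a b))"

definition associative_product :: "('v \<Rightarrow> 'v \<Rightarrow> 'v) \<Rightarrow> bool" where
  "associative_product p \<longleftrightarrow> (\<forall>a b c. p (p a b) c = p a (p b c))"

definition three_order_abelian :: "('v \<Rightarrow> 'v \<Rightarrow> 'v) \<Rightarrow> bool" where
  "three_order_abelian p \<longleftrightarrow>
     (\<forall>\<sigma>. \<sigma> permutes {1..3::nat} \<longrightarrow>
        (\<forall>X. p (p (X 1) (X 2)) (X 3) = p (p (X (\<sigma> 1)) (X (\<sigma> 2))) (X (\<sigma> 3))))"

end

theory Submission
  imports Defs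
begin

text \<open>
  The statement splits into linear algebra in arity 3 and the universal property of a presented
  operad.

  In arity 3, a permutation acts on the Lie-admissible element by its sign, so the submodule of
  Lie-admissible relations is a line. The coefficients of that element are exactly the signs in the
  bilinear form (\<open>lie_adm_element_apply\<close>), the two signs cancel, and pairing with it is summing
  coefficients. Hence the orthogonal is the hyperplane of combinations whose coefficients sum to
  zero (\<open>orthogonal_lie_adm\<close>). That hyperplane is spanned by the differences of monomials. The relations
  of associative 3-order abelian algebras are such differences, and they identify all twelve monomials,
  since the transpositions (1 2) and (2 3) generate the symmetric group; so they generate the same
  hyperplane (\<open>assoc_abelian_relations_eq\<close>). The two operads are therefore equal.

  To identify the algebras, let \<open>R\<close> be any set of relations in arity 3. A bilinear product evaluates
  monomials, and extending this linearly gives an operad homomorphism from the free operad to the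
  endomorphism operad (\<open>comb_action_hom\<close>). It is the only one with that product, because the free
  operad is generated by its binary operation (\<open>free_operad_generated\<close>). Its kernel is an operadic
  ideal (\<open>free_hom_kernel_ideal\<close>), so as soon as it kills \<open>R\<close> it kills the ideal generated by \<open>R\<close> and
  descends to the quotient. So algebras over the presented operad are the bilinear products for
  which \<open>R\<close> acts as zero (\<open>algebra_product_bij_betw\<close>), and for the relations above this is
  associativity together with \<open>abc = acb = bac\<close>.
\<close>

section \<open>Monomials and grafting\<close>

lemma leaves_map_monomial: "leaves (map_monomial f t) = map f (leaves t)"
  by (induction t) auto

lemma leaves_nonempty [simp]: "leaves t \<noteq> []"
  by (induction t) auto

lemma set_leaves_subst: "set (leaves (subst \<theta> t)) = (\<Union>j\<in>set (leaves t). set (leaves (\<theta> j)))"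
  by (induction t) auto

lemma distinct_leaves_subst:
  assumes "distinct (leaves t)" "\<And>j. j \<in> set (leaves t) \<Longrightarrow> distinct (leaves (\<theta> j))"
    and "\<And>i j. i \<in> set (leaves t) \<Longrightarrow> j \<in> set (leaves t) \<Longrightarrow> i \<noteq> j \<Longrightarrow>
           set (leaves (\<theta> i)) \<inter> set (leaves (\<theta> j)) = {}"
  shows "distinct (leaves (subst \<theta> t))"
  using assms
proof (induction t)
  case (Prod s t)
  have "set (leaves (subst \<theta> s)) \<inter> set (leaves (subst \<theta> t)) = {}"
    unfolding set_leaves_subst
  proof (safe, goal_cases)
    case (1 x i j)
    then have "i \<noteq> j" using Prod.prems(1) by auto
    then show ?case using 1 Prod.prems(3)[of i j] by auto
  qed
  moreover have "distinct (leaves (subst \<theta> s))" "distinct (leaves (subst \<theta> t))"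
    using Prod.prems by (auto intro!: Prod.IH)
  ultimately show ?case by simp
qed simp

lemma subst_cong: "(\<And>j. j \<in> set (leaves t) \<Longrightarrow> \<theta> j = \<theta>' j) \<Longrightarrow> subst \<theta> t = subst \<theta>' t"
  by (induction t) auto

lemma subst_Gen [simp]: "subst Gen t = t"
  by (induction t) auto

lemma finite_monomials [simp]: "finite (monomials n)"
proof -
  \<comment> \<open>Without the condition that labels are distinct, the claim passes to the two factors.\<close>
  have fin: "finite {t :: nat monomial. set (leaves t) \<subseteq> {1..n} \<and> length (leaves t) \<le> k}" for k
  proof (induction k)
    case (Suc k)
    let ?T = "{t :: nat monomial. set (leaves t) \<subseteq> {1..n} \<and> length (leaves t) \<le> k}"
    have "t \<in> Gen ` {1..n} \<union> (\<lambda>(r, s). r \<odot> s) ` (?T \<times> ?T)"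
      if t: "set (leaves t) \<subseteq> {1..n} \<and> length (leaves t) \<le> Suc k" for t
    proof (cases t)
      case (Prod r s)
      have "length (leaves r) + length (leaves s) \<le> Suc k" using t unfolding Prod by simp
      moreover have "length (leaves r) \<noteq> 0" "length (leaves s) \<noteq> 0" by simp_all
      ultimately have "length (leaves r) \<le> k" "length (leaves s) \<le> k" by linarith+
      then have "(r, s) \<in> ?T \<times> ?T" using t unfolding Prod by simp
      then show ?thesis unfolding Prod by force
    qed (use t in auto)
    then have "{t. set (leaves t) \<subseteq> {1..n} \<and> length (leaves t) \<le> Suc k}
        \<subseteq> Gen ` {1..n} \<union> (\<lambda>(r, s). r \<odot> s) ` (?T \<times> ?T)"
      by blast
    then show ?case by (rule finite_subset) (use Suc in simp)
  qed simp
  show ?thesis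
    by (rule finite_subset[OF _ fin[of n]]) (auto simp: monomials_def dest!: distinct_card[symmetric])
qed

lemma map_monomial_in_monomials:
  assumes "\<sigma> permutes {1..n}" "t \<in> monomials n"
  shows "map_monomial \<sigma> t \<in> monomials n"
  using assms permutes_image[OF assms(1)] permutes_inj_on[OF assms(1)]
  by (auto simp: monomials_def leaves_map_monomial distinct_map)

lemma map_monomial_inv:
  assumes "\<sigma> permutes S"
  shows "map_monomial \<sigma> (map_monomial (inv \<sigma>) t) = t"
    and "map_monomial (inv \<sigma>) (map_monomial \<sigma> t) = t"
  using permutes_inv_o[OF assms] by (simp_all add: monomial.map_comp monomial.map_id0)

text \<open>
  Grafting replaces the label \<open>i\<close> by the block of labels from \<open>i\<close> to \<open>i + n - 1\<close> and moves the later
  labels up behind that block, so the label sets of the substituted monomials partition the interval.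
  As a monomial has a leaf, \<open>n\<close> is positive and the truncated subtractions are harmless.
\<close>

lemma graft_in_monomials:
  assumes s: "s \<in> monomials m" and t: "t \<in> monomials n" and i: "i \<in> {1..m}"
  shows "graft n i s t \<in> monomials (m + n - 1)"
proof -
  have n: "n \<ge> 1"
    using t leaves_nonempty[of t] by (cases n) (auto simp: monomials_def)
  define \<theta> where "\<theta> = (\<lambda>j. if j < i then Gen j
      else if j = i then map_monomial (\<lambda>l. l + i - 1) t else Gen (j + n - 1))"
  have sub: "graft n i s t = subst \<theta> s"
    by (simp add: graft_def \<theta>_def)
  have block: "set (leaves (\<theta> i)) = {i..i + n - 1}"
  proof -
    have "(\<lambda>l. l + i - 1) ` {1..n} = {i..i + n - 1}"
    proof (safe, goal_cases)
      case (2 x)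
      then show ?case using i by (intro image_eqI[of _ _ "x + 1 - i"]) auto
    qed (use i n in auto)
    then show ?thesis
      using t by (simp add: \<theta>_def leaves_map_monomial monomials_def)
  qed
  have set_\<theta>: "set (leaves (\<theta> j)) =
      (if j < i then {j} else if j = i then {i..i + n - 1} else {j + n - 1})" for j
    using block by (simp add: \<theta>_def)
  have "distinct (leaves (subst \<theta> s))"
  proof (rule distinct_leaves_subst)
    show "distinct (leaves s)" using s by (simp add: monomials_def)
  next
    fix j :: nat
    have "inj_on (\<lambda>l. l + i - 1) {1..n}" by (auto simp: inj_on_def)
    then show "distinct (leaves (\<theta> j))"
      using t by (simp add: \<theta>_def leaves_map_monomial monomials_def distinct_map)
  next
    fix j k :: nat assume "j \<noteq> k"
    then show "set (leaves (\<theta> j)) \<inter> set (leaves (\<theta> k)) = {}"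
      unfolding set_\<theta> using n by auto
  qed
  moreover have "set (leaves (subst \<theta> s)) = {1..m + n - 1}"
  proof -
    have "set (leaves (subst \<theta> s)) = (\<Union>j\<in>{1..m}. set (leaves (\<theta> j)))"
      using s by (simp add: set_leaves_subst monomials_def)
    also have "\<dots> = {1..m + n - 1}"
    proof (intro equalityI subsetI)
      fix x assume "x \<in> {1..m + n - 1}"
      \<comment> \<open>The witness is the old label whose block contains \<open>x\<close>.\<close>
      then show "x \<in> (\<Union>j\<in>{1..m}. set (leaves (\<theta> j)))"
        using i n unfolding set_\<theta>
        by (intro UN_I[of "if x < i then x else if x \<le> i + n - 1 then i else x + 1 - n"])
          (auto split: if_splits)
    qed (use i n in \<open>auto simp: set_\<theta> split: if_splits\<close>)
    finally show ?thesis .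
  qed
  ultimately show ?thesis unfolding sub by (simp add: monomials_def)
qed

section \<open>Combinations of monomials\<close>

lemma sum_comb_apply: "(\<Sum>j\<in>J. F j) (t :: nat monomial) = (\<Sum>j\<in>J. F j t)"
  by (induction J rule: infinite_finite_induct) auto

lemma vector_space_cscale: "vector_space (cscale :: 'k::field \<Rightarrow> _)"
  by unfold_locales (auto simp: cscale_def fun_eq_iff algebra_simps)

lemma cscale_apply [simp]: "cscale c f t = c * f t"
  by (simp add: cscale_def)

lemma monom_of_apply: "monom_of t t' = (if t' = t then 1 else 0)"
  by (simp add: monom_of_def)

lemma free_space_zero [simp]: "0 \<in> free_space n"
  and free_space_add: "f \<in> free_space n \<Longrightarrow> g \<in> free_space n \<Longrightarrow> f + g \<in> free_space n"
  and free_space_diff: "f \<in> free_space n \<Longrightarrow> g \<in> free_space n \<Longrightarrow> f - g \<in> free_space n"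
  and free_space_cscale: "f \<in> free_space n \<Longrightarrow> cscale c f \<in> free_space n"
  and monom_of_in_free_space: "t \<in> monomials n \<Longrightarrow> monom_of t \<in> free_space n"
  by (auto simp: free_space_def monom_of_def)

lemma free_space_sum: "(\<And>j. j \<in> J \<Longrightarrow> F j \<in> free_space n) \<Longrightarrow> (\<Sum>j\<in>J. F j) \<in> free_space n"
  by (induction J rule: infinite_finite_induct) (auto intro: free_space_add)

lemma free_space_expansion:
  assumes "f \<in> free_space n"
  shows "f = (\<Sum>t\<in>monomials n. cscale (f t) (monom_of t))"
proof
  fix t
  show "f t = (\<Sum>t\<in>monomials n. cscale (f t) (monom_of t)) t"
    using assms by (auto simp: sum_comb_apply monom_of_apply free_space_def if_distrib cong: if_cong)
qed

lemma free_operad_simps [simp]: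
  "ops free_operad = free_space" "zero_op free_operad n = 0" "add_op free_operad n = (+)"
  "scale_op free_operad n = cscale" "unit_op free_operad = monom_of (Gen 1)"
  by (simp_all add: free_operad_def)

lemma perm_free_operad:
  "perm_op free_operad n \<sigma> f = (\<Sum>t\<in>monomials n. cscale (f t) (monom_of (map_monomial \<sigma> t)))"
  by (simp add: free_operad_def)

lemma comp_free_operad:
  "comp_op free_operad m n i f g =
     (\<Sum>s\<in>monomials m. \<Sum>t\<in>monomials n. cscale (f s * g t) (monom_of (graft n i s t)))"
  by (simp add: free_operad_def)

lemma perm_in_free_space:
  "\<sigma> permutes {1..n} \<Longrightarrow> perm_op free_operad n \<sigma> f \<in> free_space n"
  unfolding perm_free_operad
  by (intro free_space_sum free_space_cscale monom_of_in_free_space map_monomial_in_monomials)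

lemma comp_in_free_space:
  "i \<in> {1..m} \<Longrightarrow> comp_op free_operad m n i f g \<in> free_space (m + n - 1)"
  unfolding comp_free_operad
  by (intro free_space_sum free_space_cscale monom_of_in_free_space graft_in_monomials)

lemma perm_free_operad_diff:
  "perm_op free_operad n \<sigma> (f - g) = perm_op free_operad n \<sigma> f - perm_op free_operad n \<sigma> g"
  by (rule ext) (simp add: perm_free_operad sum_comb_apply algebra_simps sum_subtractf)

lemma comp_free_operad_diff:
  "comp_op free_operad m n i (f - f') g =
     comp_op free_operad m n i f g - comp_op free_operad m n i f' g"
  "comp_op free_operad m n i f (g - g') =
     comp_op free_operad m n i f g - comp_op free_operad m n i f g'"
  by (rule ext, simp add: comp_free_operad sum_comb_apply algebra_simps sum_subtractf)+

lemma perm_monom_of: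
  assumes "t \<in> monomials n"
  shows "perm_op free_operad n \<sigma> (monom_of t) = (monom_of (map_monomial \<sigma> t) :: 'k::field comb)"
proof -
  have "perm_op free_operad n \<sigma> (monom_of t) =
      (\<Sum>s\<in>monomials n. if s = t then monom_of (map_monomial \<sigma> s) else (0 :: 'k comb))"
    unfolding perm_free_operad by (intro sum.cong) (auto simp: monom_of_apply fun_eq_iff)
  then show ?thesis using assms by simp
qed

lemma comp_monom_of:
  assumes "s \<in> monomials m" "t \<in> monomials n"
  shows "comp_op free_operad m n i (monom_of s) (monom_of t) =
    (monom_of (graft n i s t) :: 'k::field comb)"
proof -
  have "comp_op free_operad m n i (monom_of s) (monom_of t) =
      (\<Sum>s'\<in>monomials m. \<Sum>t'\<in>monomials n.
         if t' = t then if s' = s then monom_of (graft n i s' t') else (0 :: 'k comb) else 0)"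
    unfolding comp_free_operad by (intro sum.cong) (auto simp: monom_of_apply fun_eq_iff)
  then show ?thesis using assms by simp
qed

lemma perm_apply_map:
  assumes \<sigma>: "\<sigma> permutes {1..n}" and t: "t \<in> monomials n"
  shows "perm_op free_operad n \<sigma> f (map_monomial \<sigma> t) = f t"
proof -
  have "map_monomial \<sigma> t = map_monomial \<sigma> s \<longleftrightarrow> t = s" for s
    using map_monomial_inv(2)[OF \<sigma>] by metis
  then have "perm_op free_operad n \<sigma> f (map_monomial \<sigma> t) = (\<Sum>s\<in>monomials n. if t = s then f s else 0)"
    unfolding perm_free_operad sum_comb_apply by (intro sum.cong) (auto simp: monom_of_apply)
  then show ?thesis using t by simp
qed

text \<open>
  A planar monomial, whose labels read 1, 2, ... from left to right, is built from the binary
  generator alone by grafting its two factors into the two slots of the generator; a permutation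
  then produces every other labelling. So a family of subspaces stable under the operad operations
  and containing the unit and the generator is everything.
\<close>

lemma free_operad_generated:
  fixes S :: "nat \<Rightarrow> 'k::field comb set"
  assumes zero: "\<And>n. 0 \<in> S n"
    and add: "\<And>n f g. f \<in> S n \<Longrightarrow> g \<in> S n \<Longrightarrow> f + g \<in> S n"
    and scale: "\<And>n c f. f \<in> S n \<Longrightarrow> cscale c f \<in> S n"
    and perm: "\<And>n \<sigma> f. \<sigma> permutes {1..n} \<Longrightarrow> f \<in> S n \<Longrightarrow> perm_op free_operad n \<sigma> f \<in> S n"
    and comp: "\<And>m n i f g. i \<in> {1..m} \<Longrightarrow> f \<in> S m \<Longrightarrow> g \<in> S n \<Longrightarrow>
                 comp_op free_operad m n i f g \<in> S (m + n - 1)"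
    and unit: "monom_of (Gen 1) \<in> S 1"
    and gen: "monom_of (Gen 1 \<odot> Gen 2) \<in> S 2"
    and f: "f \<in> free_space n"
  shows "f \<in> S n"
proof -
  have planar: "monom_of (map_monomial (\<lambda>l. l - k) t) \<in> S n" if "leaves t = [k + 1..<k + n + 1]"
    for k n t
    \<comment> \<open>The right factor of a planar monomial has its labels shifted, hence the offset \<open>k\<close>.\<close>
    using that
  proof (induction t arbitrary: k n)
    case (Gen a)
    then have "length [a] = length [k + 1..<k + n + 1]" by simp
    then have "n = 1" by (simp del: upt_Suc)
    then show ?case using Gen unit by simp
  next
    case (Prod s t)
    define a b where "a = length (leaves s)" and "b = length (leaves t)"
    have "length (leaves s @ leaves t) = length [k + 1..<k + n + 1]" using Prod.prems by simp
    then have n: "n = a + b" by (simp add: a_def b_def)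
    have "leaves s @ leaves t = [k + 1..<k + a + 1] @ [k + a + 1..<(k + a) + b + 1]"
      using Prod.prems upt_add_eq_append[of "k + 1" "k + a + 1" b] by (simp add: n add.assoc add.left_commute)
    then have ls: "leaves s = [k + 1..<k + a + 1]" and lt: "leaves t = [k + a + 1..<(k + a) + b + 1]"
      by (simp_all add: a_def b_def append_eq_append_conv del: upt_Suc)
    define s' t' where "s' = map_monomial (\<lambda>l. l - k) s" and "t' = map_monomial (\<lambda>l. l - (k + a)) t"
    have shift: "map (\<lambda>l. l - k) [k + 1..<k + n + 1] = [1..<n + 1]" for k n :: nat
      by (rule nth_equalityI) (auto simp del: upt_Suc)
    have s': "leaves s' = [1..<a + 1]" and t': "leaves t' = [1..<b + 1]"
      unfolding s'_def t'_def leaves_map_monomial ls lt by (rule shift)+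
    have s'_mono: "s' \<in> monomials a" and t'_mono: "t' \<in> monomials b"
      by (auto simp: monomials_def s' t')
    have pair: "Gen 1 \<odot> Gen 2 \<in> monomials 2" by (auto simp: monomials_def)
    have left: "graft a 1 (Gen 1 \<odot> Gen 2) s' = s' \<odot> Gen (a + 1)"
      by (simp add: graft_def monomial.map_ident)
    define \<theta> where "\<theta> = (\<lambda>j. if j < a + 1 then Gen j
        else if j = a + 1 then map_monomial (\<lambda>l. l + (a + 1) - 1) t' else Gen (j + b - 1))"
    have "subst \<theta> s' = s'"
      by (rule trans[OF subst_cong subst_Gen]) (auto simp: s' \<theta>_def)
    moreover have "map_monomial (\<lambda>l. l + a) t' = map_monomial (\<lambda>l. l - k) t"
      unfolding t'_def monomial.map_comp
    proof (rule monomial.map_cong[OF refl])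
      have "set_monomial t = set (leaves t)" by (induction t) auto
      then show "((\<lambda>l. l + a) \<circ> (\<lambda>l. l - (k + a))) l = l - k" if "l \<in> set_monomial t" for l
        using that by (auto simp: lt)
    qed
    ultimately have whole: "graft b (a + 1) (s' \<odot> Gen (a + 1)) t' = map_monomial (\<lambda>l. l - k) (s \<odot> t)"
      unfolding graft_def \<theta>_def[symmetric] by (simp add: \<theta>_def s'_def)
    have left_mono: "s' \<odot> Gen (a + 1) \<in> monomials (2 + a - 1)"
      using graft_in_monomials[OF pair s'_mono, of 1] left by simp
    have "monom_of s' \<in> S a" "monom_of t' \<in> S b"
      using Prod.IH(1)[OF ls] Prod.IH(2)[OF lt] by (simp_all add: s'_def t'_def)
    moreover from comp[OF _ gen this(1), of 1] have "monom_of (s' \<odot> Gen (a + 1)) \<in> S (2 + a - 1)"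
      by (simp only: comp_monom_of[OF pair s'_mono] left) simp
    ultimately have "monom_of (graft b (a + 1) (s' \<odot> Gen (a + 1)) t') \<in> S (2 + a - 1 + b - 1)"
      using comp[of "a + 1" "2 + a - 1" "monom_of (s' \<odot> Gen (a + 1))" "monom_of t'" b]
      by (simp only: comp_monom_of[OF left_mono t'_mono]) simp
    moreover have "2 + a - 1 + b - 1 = a + b" by simp
    ultimately show ?case by (simp only: whole n)
  qed
  have monom: "monom_of t \<in> S n" if t: "t \<in> monomials n" for t
  proof -
    let ?L = "leaves t"
    have len: "length ?L = n"
      using t distinct_card[of ?L] by (simp add: monomials_def)
    \<comment> \<open>The permutation that carries the planar labelling of the same tree to the labelling of \<open>t\<close>.\<close>
    define \<sigma> where "\<sigma> l = (if l \<in> {1..n} then ?L ! (l - 1) else l)" for l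
    have "bij_betw (\<lambda>l. ?L ! (l - 1)) {1..n} {1..n}"
    proof -
      have "bij_betw (\<lambda>l. l - 1) {1..n} {..<n}"
        by (rule bij_betw_byWitness[where f' = Suc]) auto
      moreover have "bij_betw ((!) ?L) {..<n} {1..n}"
        using t bij_betw_nth[of ?L "{..<n}" "{1..n}"] len by (simp add: monomials_def)
      ultimately show ?thesis using bij_betw_trans by (fastforce simp: comp_def)
    qed
    then have "bij_betw \<sigma> {1..n} {1..n}"
      by (rule bij_betw_cong[THEN iffD1, rotated]) (simp add: \<sigma>_def)
    then have \<sigma>: "\<sigma> permutes {1..n}"
      by (rule bij_imp_permutes) (auto simp: \<sigma>_def)
    define t0 where "t0 = map_monomial (inv \<sigma>) t"
    have "map \<sigma> [1..<n + 1] = ?L"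
      by (rule nth_equalityI) (auto simp: \<sigma>_def len simp del: upt_Suc)
    then have "map (inv \<sigma>) ?L = [1..<n + 1]"
      using permutes_inv_o(2)[OF \<sigma>] by (metis list.map_comp list.map_id)
    then have L0: "leaves t0 = [0 + 1..<0 + n + 1]"
      by (simp add: t0_def leaves_map_monomial)
    then have "t0 \<in> monomials n" by (auto simp: monomials_def)
    moreover have "monom_of t0 \<in> S n"
      using planar[OF L0] by (simp add: monomial.map_ident)
    ultimately show ?thesis
      using perm[OF \<sigma>, of "monom_of t0"] map_monomial_inv(1)[OF \<sigma>, of t]
      by (simp add: perm_monom_of t0_def)
  qed
  have "(\<Sum>t\<in>T. cscale (f t) (monom_of t)) \<in> S n" if "T \<subseteq> monomials n" for T
    using that
    by (induction T rule: infinite_finite_induct) (auto intro: zero add scale monom)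
  then show ?thesis
    using free_space_expansion[OF f] by (metis order_refl)
qed

section \<open>Evaluating monomials in an algebra\<close>

primrec eval_monomial :: "('v \<Rightarrow> 'v \<Rightarrow> 'v) \<Rightarrow> (nat \<Rightarrow> 'v) \<Rightarrow> nat monomial \<Rightarrow> 'v" where
  "eval_monomial p x (Gen j) = x j"
| "eval_monomial p x (s \<odot> t) = p (eval_monomial p x s) (eval_monomial p x t)"

definition comb_action ::
    "('k::field \<Rightarrow> 'v::ab_group_add \<Rightarrow> 'v) \<Rightarrow> ('v \<Rightarrow> 'v \<Rightarrow> 'v) \<Rightarrow> nat \<Rightarrow> 'k comb \<Rightarrow> (nat \<Rightarrow> 'v) \<Rightarrow> 'v" where
  "comb_action scale p n f x = (\<Sum>t\<in>monomials n. scale (f t) (eval_monomial p x t))"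

lemma eval_map_monomial: "eval_monomial p x (map_monomial \<sigma> t) = eval_monomial p (\<lambda>j. x (\<sigma> j)) t"
  by (induction t) auto

lemma eval_subst: "eval_monomial p x (subst \<theta> t) = eval_monomial p (\<lambda>j. eval_monomial p x (\<theta> j)) t"
  by (induction t) auto

lemma eval_graft:
  "eval_monomial p x (graft n i s t) =
     eval_monomial p (\<lambda>j. if j < i then x j
        else if j = i then eval_monomial p (\<lambda>l. x (l + i - 1)) t else x (j + n - 1)) s"
  unfolding graft_def eval_subst
  by (rule arg_cong[where f = "\<lambda>y. eval_monomial p y s"]) (auto simp: eval_map_monomial)

lemma eval_cong:
  "(\<And>j. j \<in> set (leaves t) \<Longrightarrow> x j = y j) \<Longrightarrow> eval_monomial p x t = eval_monomial p y t"
  by (induction t) auto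

lemma bilinear_product_vector_space: "bilinear_product scale p \<Longrightarrow> vector_space scale"
  by (auto simp: bilinear_product_def Vector_Spaces.linear_iff)

lemma linear_eval_monomial:
  assumes B: "bilinear_product scale p"
    and "distinct (leaves t)" "i \<in> set (leaves t)"
  shows "Vector_Spaces.linear scale scale (\<lambda>v. eval_monomial p (x(i := v)) t)"
  using assms(2,3)
proof (induction t)
  case (Gen a)
  then show ?case
    using bilinear_product_vector_space[OF B] by (simp add: Vector_Spaces.linear_iff)
next
  case (Prod s t)
  show ?case
  proof (cases "i \<in> set (leaves s)")
    case True
    then have "eval_monomial p (x(i := v)) t = eval_monomial p x t" for v
      using Prod.prems by (intro eval_cong) auto
    moreover have "Vector_Spaces.linear scale scale (\<lambda>v. eval_monomial p (x(i := v)) s)"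
      using Prod.prems True by (intro Prod.IH(1)) auto
    ultimately show ?thesis
      using B by (simp add: bilinear_product_def Vector_Spaces.linear_iff del: fun_upd_apply)
  next
    case False
    then have "eval_monomial p (x(i := v)) s = eval_monomial p x s" for v
      by (intro eval_cong) auto
    moreover have "Vector_Spaces.linear scale scale (\<lambda>v. eval_monomial p (x(i := v)) t)"
      using Prod.prems False by (intro Prod.IH(2)) auto
    ultimately show ?thesis
      using B by (simp add: bilinear_product_def Vector_Spaces.linear_iff del: fun_upd_apply)
  qed
qed

lemma comb_action_combination:
  assumes "vector_space scale" "finite J" "\<And>j. j \<in> J \<Longrightarrow> u j \<in> monomials n"
  shows "comb_action scale p n (\<Sum>j\<in>J. cscale (c j) (monom_of (u j))) x =
    (\<Sum>j\<in>J. scale (c j) (eval_monomial p x (u j)))"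
proof -
  interpret vector_space scale by fact
  have "comb_action scale p n (\<Sum>j\<in>J. cscale (c j) (monom_of (u j))) x =
      (\<Sum>t\<in>monomials n. \<Sum>j\<in>J. if t = u j then scale (c j) (eval_monomial p x t) else 0)"
    unfolding comb_action_def sum_comb_apply scale_sum_left
    by (intro sum.cong) (auto simp: monom_of_apply)
  also have "\<dots> = (\<Sum>j\<in>J. \<Sum>t\<in>monomials n. if t = u j then scale (c j) (eval_monomial p x t) else 0)"
    by (rule sum.swap)
  also have "\<dots> = (\<Sum>j\<in>J. scale (c j) (eval_monomial p x (u j)))"
    using assms(3) by (intro sum.cong) auto
  finally show ?thesis .
qed

lemma comb_action_monom_of:
  fixes scale :: "'k::field \<Rightarrow> 'v::ab_group_add \<Rightarrow> 'v"
  assumes "vector_space scale" "t \<in> monomials n"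
  shows "comb_action scale p n (monom_of t) x = eval_monomial p x t"
proof -
  interpret vector_space scale by fact
  have "cscale 1 (monom_of t) = (monom_of t :: 'k comb)" by (simp add: fun_eq_iff)
  then show ?thesis
    using comb_action_combination[of scale "{t}" id n p "\<lambda>_. 1" x] assms by simp
qed

lemma comb_action_linear:
  assumes "vector_space scale"
  shows "comb_action scale p n 0 x = 0"
    and "comb_action scale p n (f + g) x = comb_action scale p n f x + comb_action scale p n g x"
    and "comb_action scale p n (f - g) x = comb_action scale p n f x - comb_action scale p n g x"
    and "comb_action scale p n (cscale c f) x = scale c (comb_action scale p n f x)"
proof -
  interpret vector_space scale by fact
  show "comb_action scale p n 0 x = 0"
    and "comb_action scale p n (f + g) x = comb_action scale p n f x + comb_action scale p n g x"
    and "comb_action scale p n (f - g) x = comb_action scale p n f x - comb_action scale p n g x"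
    and "comb_action scale p n (cscale c f) x = scale c (comb_action scale p n f x)"
    by (simp_all add: comb_action_def scale_left_distrib scale_left_diff_distrib sum.distrib
        sum_subtractf scale_sum_right)
qed

lemma comb_action_multilinear:
  assumes B: "bilinear_product scale p"
  shows "comb_action scale p n f \<in> multilinear_ops scale n"
proof -
  interpret vector_space scale by (rule bilinear_product_vector_space[OF B])
  have "comb_action scale p n f x = comb_action scale p n f y" if "\<forall>i\<in>{1..n}. x i = y i" for x y
    unfolding comb_action_def using that
    by (intro sum.cong refl arg_cong[where f = "scale _"] eval_cong) (auto simp: monomials_def)
  moreover have "Vector_Spaces.linear scale scale (\<lambda>v. comb_action scale p n f (x(i := v)))"
    if i: "i \<in> {1..n}" for i x
  proof -
    have "Vector_Spaces.linear scale scale (\<lambda>v. eval_monomial p (x(i := v)) t)"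
      if "t \<in> monomials n" for t
      using that i by (intro linear_eval_monomial[OF B]) (auto simp: monomials_def)
    then show ?thesis
      unfolding Vector_Spaces.linear_iff comb_action_def
      by (auto simp: scale_right_distrib sum.distrib scale_sum_right vector_space_axioms
          mult.commute intro!: sum.cong)
  qed
  ultimately show ?thesis
    unfolding multilinear_ops_def by blast
qed

lemma End_operad_simps [simp]:
  "ops (End_operad scale) = multilinear_ops scale"
  "add_op (End_operad scale) n f g = (\<lambda>x. f x + g x)"
  "scale_op (End_operad scale) n c f = (\<lambda>x. scale c (f x))"
  "perm_op (End_operad scale) n \<sigma> f = (\<lambda>x. f (\<lambda>j. x (\<sigma> j)))"
  "unit_op (End_operad scale) = (\<lambda>x. x 1)"
  by (simp_all add: End_operad_def)

lemma comp_End_operad: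
  "comp_op (End_operad scale) m n i f g x =
     f ((\<lambda>j. if j < i then x j else x (j + n - 1))(i := g (\<lambda>l. x (l + i - 1))))"
  unfolding End_operad_def by (auto intro!: arg_cong[where f = f])

lemma comb_action_perm:
  assumes "vector_space scale" "\<sigma> permutes {1..n}"
  shows "comb_action scale p n (perm_op free_operad n \<sigma> f) x = comb_action scale p n f (\<lambda>j. x (\<sigma> j))"
  unfolding perm_free_operad
  by (subst comb_action_combination)
    (simp_all add: assms map_monomial_in_monomials[OF assms(2)] comb_action_def eval_map_monomial)

text \<open>
  Both sides are sums over pairs of monomials; expanding the operation in the slot \<open>i\<close> uses that a
  monomial is linear in each of its variables.
\<close>

lemma comb_action_comp:
  fixes scale :: "'k::field \<Rightarrow> 'v::ab_group_add \<Rightarrow> 'v"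
  assumes B: "bilinear_product scale p" and i: "i \<in> {1..m}"
  shows "comb_action scale p (m + n - 1) (comp_op free_operad m n i f g) =
    comp_op (End_operad scale) m n i (comb_action scale p m f) (comb_action scale p n g)"
proof
  fix x :: "nat \<Rightarrow> 'v"
  interpret vector_space scale by (rule bilinear_product_vector_space[OF B])
  define y where "y = (\<lambda>j. if j < i then x j else x (j + n - 1))"
  define e where "e = eval_monomial p (\<lambda>l. x (l + i - 1))"
  have graft: "eval_monomial p x (graft n i s t) = eval_monomial p (y(i := e t)) s" for s t
    unfolding eval_graft by (rule arg_cong[where f = "\<lambda>y. eval_monomial p y s"]) (auto simp: y_def e_def)
  have "(case st of (s, t) \<Rightarrow> graft n i s t) \<in> monomials (m + n - 1)"
    if "st \<in> monomials m \<times> monomials n" for st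
    using that graft_in_monomials[OF _ _ i] by (auto simp del: One_nat_def)
  from comb_action_combination[OF vector_space_axioms _ this, of "monomials m \<times> monomials n" "\<lambda>st. st" p "\<lambda>(s, t). f s * g t" x]
  have "comb_action scale p (m + n - 1) (comp_op free_operad m n i f g) x =
      (\<Sum>(s, t)\<in>monomials m \<times> monomials n. scale (f s * g t) (eval_monomial p x (graft n i s t)))"
    unfolding comp_free_operad sum.cartesian_product
    by (simp add: case_prod_unfold)
  also have "\<dots> = (\<Sum>s\<in>monomials m. \<Sum>t\<in>monomials n. scale (f s * g t) (eval_monomial p (y(i := e t)) s))"
    by (simp add: sum.cartesian_product graft)
  also have "\<dots> = (\<Sum>s\<in>monomials m. scale (f s)
      (eval_monomial p (y(i := \<Sum>t\<in>monomials n. scale (g t) (e t))) s))"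
  proof (rule sum.cong[OF refl])
    fix s assume "s \<in> monomials m"
    then have "Vector_Spaces.linear scale scale (\<lambda>v. eval_monomial p (y(i := v)) s)"
      using i by (intro linear_eval_monomial[OF B]) (auto simp: monomials_def)
    then interpret L: Vector_Spaces.linear scale scale "\<lambda>v. eval_monomial p (y(i := v)) s" .
    show "(\<Sum>t\<in>monomials n. scale (f s * g t) (eval_monomial p (y(i := e t)) s)) =
        scale (f s) (eval_monomial p (y(i := \<Sum>t\<in>monomials n. scale (g t) (e t))) s)"
      by (simp add: L.sum L.scale scale_sum_right)
  qed
  finally show "comb_action scale p (m + n - 1) (comp_op free_operad m n i f g) x =
      comp_op (End_operad scale) m n i (comb_action scale p m f) (comb_action scale p n g) x"
    by (simp add: comp_End_operad comb_action_def y_def e_def)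
qed

text \<open>
  The restriction to the arity \<open>n\<close> space only serves to make the family extensional, as homomorphisms
  are required to be.
\<close>

lemma comb_action_hom:
  assumes B: "bilinear_product scale p"
  shows "(\<lambda>n. restrict (comb_action scale p n) (free_space n)) \<in> operad_homs free_operad (End_operad scale)"
proof -
  have V: "vector_space scale" by (rule bilinear_product_vector_space[OF B])
  have "Gen 1 \<in> monomials 1" by (simp add: monomials_def)
  then have "comb_action scale p 1 (monom_of (Gen 1)) = (\<lambda>x. x 1)"
    by (simp add: comb_action_monom_of[OF V] fun_eq_iff)
  moreover have "monom_of (Gen 1) \<in> free_space 1"
    by (rule monom_of_in_free_space) fact
  ultimately show ?thesis
    unfolding operad_homs_def
    by (auto simp: comb_action_multilinear[OF B] comb_action_linear[OF V] comb_action_perm[OF V]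
        free_space_add free_space_cscale perm_in_free_space comp_in_free_space comb_action_comp[OF B]
        simp del: One_nat_def)
qed

section \<open>Homomorphisms from the free operad to an endomorphism operad\<close>

lemma free_homD:
  assumes "\<psi> \<in> operad_homs free_operad (End_operad scale)"
  shows "f \<in> free_space n \<Longrightarrow> \<psi> n f \<in> multilinear_ops scale n"
    and "f \<in> free_space n \<Longrightarrow> g \<in> free_space n \<Longrightarrow> \<psi> n (f + g) = (\<lambda>x. \<psi> n f x + \<psi> n g x)"
    and "f \<in> free_space n \<Longrightarrow> \<psi> n (cscale c f) = (\<lambda>x. scale c (\<psi> n f x))"
    and "\<sigma> permutes {1..n} \<Longrightarrow> f \<in> free_space n \<Longrightarrow>
           \<psi> n (perm_op free_operad n \<sigma> f) = (\<lambda>x. \<psi> n f (\<lambda>j. x (\<sigma> j)))"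
    and "i \<in> {1..m} \<Longrightarrow> f \<in> free_space m \<Longrightarrow> g \<in> free_space n \<Longrightarrow>
           \<psi> (m + n - 1) (comp_op free_operad m n i f g) = comp_op (End_operad scale) m n i (\<psi> m f) (\<psi> n g)"
    and "\<psi> 1 (monom_of (Gen 1)) = (\<lambda>x. x 1)"
  using assms unfolding operad_homs_def by auto

lemma free_hom_zero:
  assumes "vector_space scale" "\<psi> \<in> operad_homs free_operad (End_operad scale)"
  shows "\<psi> n 0 = (\<lambda>x. 0)"
proof -
  interpret vector_space scale by fact
  have "cscale 0 0 = (0 :: 'a comb)" by (simp add: fun_eq_iff)
  then show ?thesis using free_homD(3)[OF assms(2), of 0 n 0] by simp
qed

text \<open>
  The elements on which two homomorphisms agree are stable under all operations, so agreement on the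
  binary generator suffices. The value at zero is forced by homogeneity with the scalar zero.
\<close>

lemma free_hom_eqI:
  assumes V: "vector_space scale"
    and \<psi>: "\<psi> \<in> operad_homs free_operad (End_operad scale)"
    and \<psi>': "\<psi>' \<in> operad_homs free_operad (End_operad scale)"
    and gen: "\<psi> 2 (monom_of (Gen 1 \<odot> Gen 2)) = \<psi>' 2 (monom_of (Gen 1 \<odot> Gen 2))"
    and f: "f \<in> free_space n"
  shows "\<psi> n f = \<psi>' n f"
proof -
  have "Gen 1 \<in> monomials 1" "Gen 1 \<odot> Gen 2 \<in> monomials 2" by (auto simp: monomials_def)
  note base = this[THEN monom_of_in_free_space]
  have "f \<in> {f \<in> free_space n. \<psi> n f = \<psi>' n f}"
  proof (rule free_operad_generated[OF _ _ _ _ _ _ _ f], goal_cases)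
    case (1 n)
    show ?case by (simp add: free_hom_zero[OF V \<psi>] free_hom_zero[OF V \<psi>'])
  next
    case (2 n f g)
    then show ?case by (simp add: free_homD(2)[OF \<psi>] free_homD(2)[OF \<psi>'] free_space_add)
  next
    case (3 n c f)
    then show ?case by (simp add: free_homD(3)[OF \<psi>] free_homD(3)[OF \<psi>'] free_space_cscale)
  next
    case (4 n \<sigma> f)
    then show ?case by (simp add: free_homD(4)[OF \<psi>] free_homD(4)[OF \<psi>'] perm_in_free_space)
  next
    case (5 m n i f g)
    then show ?case by (simp add: free_homD(5)[OF \<psi>] free_homD(5)[OF \<psi>'] comp_in_free_space del: One_nat_def)
  next
    case 6
    then show ?case using base by (simp add: free_homD(6)[OF \<psi>, simplified] free_homD(6)[OF \<psi>', simplified])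
  next
    case 7
    then show ?case using base gen by simp
  qed
  then show ?thesis by simp
qed

lemma generator_product:
  assumes "f \<in> multilinear_ops scale 2"
  defines "p \<equiv> (\<lambda>a b. f (\<lambda>j. if j = 1 then a else b))"
  shows "bilinear_product scale p" and "f x = p (x 1) (x 2)"
proof -
  have dep: "f x = f y" if "x 1 = y 1" "x 2 = y 2" for x y
  proof -
    have "\<forall>i\<in>{1..2}. x i = y i"
    proof
      fix i :: nat assume "i \<in> {1..2}"
      then have "i = 1 \<or> i = 2" by auto
      then show "x i = y i" using that by auto
    qed
    then show ?thesis using assms(1) unfolding multilinear_ops_def by blast
  qed
  show "f x = p (x 1) (x 2)" unfolding p_def by (rule dep) auto
  have lin: "Vector_Spaces.linear scale scale (\<lambda>v. f (x(i := v)))" if "i \<in> {1..2}" for i x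
    using assms(1) that unfolding multilinear_ops_def by blast
  have "p a = (\<lambda>b. f ((\<lambda>_. a)(2 := b)))" for a
    unfolding p_def by (intro ext dep) auto
  moreover have "(\<lambda>a. p a b) = (\<lambda>a. f ((\<lambda>_. b)(1 := a)))" for b
    unfolding p_def by (intro ext dep) auto
  ultimately show "bilinear_product scale p"
    unfolding bilinear_product_def using lin by simp
qed

text \<open>
  A binary multilinear operation is a bilinear product, and the action of that product on combinations
  agrees with the given homomorphism on the generator, hence everywhere.
\<close>

lemma free_hom_is_comb_action:
  assumes \<psi>: "\<psi> \<in> operad_homs free_operad (End_operad scale)"
    and f: "f \<in> free_space n"
  defines "p \<equiv> (\<lambda>a b. \<psi> 2 (monom_of (Gen 1 \<odot> Gen 2)) (\<lambda>j. if j = 1 then a else b))"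
  shows "bilinear_product scale p" and "\<psi> n f = comb_action scale p n f"
proof -
  have gen: "Gen 1 \<odot> Gen 2 \<in> monomials 2" by (auto simp: monomials_def)
  note gen_free = monom_of_in_free_space[OF gen]
  note prod = generator_product[OF free_homD(1)[OF \<psi> gen_free]]
  show B: "bilinear_product scale p" unfolding p_def by (rule prod(1))
  have prod_eq: "\<psi> 2 (monom_of (Gen 1 \<odot> Gen 2)) x = p (x 1) (x 2)" for x
    unfolding p_def by (rule prod(2))
  have V: "vector_space scale" by (rule bilinear_product_vector_space[OF B])
  have "\<psi> 2 (monom_of (Gen 1 \<odot> Gen 2)) = comb_action scale p 2 (monom_of (Gen 1 \<odot> Gen 2))"
    by (rule ext) (simp only: prod_eq comb_action_monom_of[OF V gen] eval_monomial.simps)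
  then have "\<psi> n f = restrict (comb_action scale p n) (free_space n) f"
    by (intro free_hom_eqI[OF V \<psi> comb_action_hom[OF B] _ f]) (simp add: gen_free del: One_nat_def)
  then show "\<psi> n f = comb_action scale p n f" using f by simp
qed

text \<open>
  Composition with the zero operation gives zero in either argument: in the first trivially, in the
  second by linearity in the slot that is filled.
\<close>

lemma free_hom_kernel_ideal:
  assumes V: "vector_space scale" and \<psi>: "\<psi> \<in> operad_homs free_operad (End_operad scale)"
  shows "operadic_ideal free_operad (\<lambda>n. {f \<in> free_space n. \<psi> n f = (\<lambda>x. 0)})"
proof -
  interpret vector_space scale by fact
  have "comp_op (End_operad scale) m n i F (\<lambda>x. 0) = (\<lambda>x. 0)"
    if "F \<in> multilinear_ops scale m" "i \<in> {1..m}" for F m n i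
  proof
    fix x
    have "Vector_Spaces.linear scale scale
        (\<lambda>v. F ((\<lambda>j. if j < i then x j else x (j + n - 1))(i := v)))"
      using that unfolding multilinear_ops_def by blast
    then interpret L: Vector_Spaces.linear scale scale
      "\<lambda>v. F ((\<lambda>j. if j < i then x j else x (j + n - 1))(i := v))" .
    show "comp_op (End_operad scale) m n i F (\<lambda>x. 0) x = 0"
      using L.zero by (simp add: comp_End_operad)
  qed
  moreover have "comp_op (End_operad scale) m n i (\<lambda>x. 0) G = (\<lambda>x. 0)" for m n i G
    by (simp add: comp_End_operad fun_eq_iff)
  ultimately show ?thesis
    unfolding operadic_ideal_def
    by (auto simp: free_hom_zero[OF V \<psi>] free_homD[OF \<psi>] free_space_add free_space_cscale
        perm_in_free_space comp_in_free_space simp del: One_nat_def)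
qed

section \<open>Quotients of the free operad\<close>

lemma generated_ideal_least: "operadic_ideal P I \<Longrightarrow> X \<le> I \<Longrightarrow> generated_ideal P X \<le> I"
  unfolding generated_ideal_def by (rule Inf_lower) simp

text \<open>
  The ideal \<open>J\<close> makes the family to be intersected nonempty; otherwise the intersection would not be
  contained in the operad.
\<close>

lemma operadic_ideal_generated:
  assumes "operadic_ideal P J" "X \<le> J"
  shows "operadic_ideal P (generated_ideal P X)" and "X \<le> generated_ideal P X"
proof -
  have gen: "f \<in> generated_ideal P X n \<longleftrightarrow> (\<forall>I. operadic_ideal P I \<and> X \<le> I \<longrightarrow> f \<in> I n)" for f n
    by (auto simp: generated_ideal_def)
  show "operadic_ideal P (generated_ideal P X)"
    unfolding operadic_ideal_def[of P "generated_ideal P X"]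
  proof (intro conjI, goal_cases)
    case 1
    show ?case using assms unfolding operadic_ideal_def by (metis gen assms subset_eq)
  qed (auto simp: gen operadic_ideal_def)
  show "X \<le> generated_ideal P X"
    unfolding generated_ideal_def by (rule Inf_greatest) simp
qed

lemma operadic_ideal_free_space: "operadic_ideal free_operad free_space"
  unfolding operadic_ideal_def
  by (auto simp: free_space_add free_space_cscale perm_in_free_space comp_in_free_space
      simp del: One_nat_def)

lemma relation_ideal:
  assumes "R \<subseteq> free_space 3"
  shows "operadic_ideal free_operad (relation_ideal R)" and "R \<subseteq> relation_ideal R 3"
proof -
  have "(\<lambda>n. if n = 3 then R else {}) \<le> free_space"
    using assms by (auto simp: le_fun_def)
  note gen = operadic_ideal_generated[OF operadic_ideal_free_space this, folded relation_ideal_def]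
  show "operadic_ideal free_operad (relation_ideal R)" by (rule gen(1))
  show "R \<subseteq> relation_ideal R 3" using gen(2)[THEN le_funD, of 3] by simp
qed

lemma UN_constant_on: "A \<noteq> {} \<Longrightarrow> (\<And>a. a \<in> A \<Longrightarrow> F a = B) \<Longrightarrow> (\<Union>a\<in>A. F a) = B"
  by auto

locale free_operad_ideal =
  fixes I :: "nat \<Rightarrow> 'k::field comb set"
  assumes ideal: "operadic_ideal free_operad I"
begin

abbreviation coset :: "nat \<Rightarrow> 'k comb \<Rightarrow> 'k comb set" where
  "coset \<equiv> op_coset free_operad I"

abbreviation quotient :: "('k, 'k comb set) operad" where
  "quotient \<equiv> quotient_operad free_operad I"

lemma ideal_subset: "I n \<subseteq> free_space n"
  and ideal_zero: "0 \<in> I n"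
  and ideal_add: "f \<in> I n \<Longrightarrow> g \<in> I n \<Longrightarrow> f + g \<in> I n"
  and ideal_scale: "f \<in> I n \<Longrightarrow> cscale c f \<in> I n"
  and ideal_perm: "\<sigma> permutes {1..n} \<Longrightarrow> f \<in> I n \<Longrightarrow> perm_op free_operad n \<sigma> f \<in> I n"
  and ideal_comp: "i \<in> {1..m} \<Longrightarrow> f \<in> I m \<Longrightarrow> g \<in> free_space n \<Longrightarrow>
        comp_op free_operad m n i f g \<in> I (m + n - 1)"
    "i \<in> {1..m} \<Longrightarrow> f' \<in> free_space m \<Longrightarrow> g' \<in> I n \<Longrightarrow>
        comp_op free_operad m n i f' g' \<in> I (m + n - 1)"
  using ideal unfolding operadic_ideal_def by (auto simp del: One_nat_def)

lemma ideal_diff: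
  assumes "f \<in> I n" "g \<in> I n"
  shows "f - g \<in> I n"
proof -
  have "f - g = f + cscale (-1) g" by (simp add: fun_eq_iff)
  then show ?thesis using ideal_add[OF assms(1) ideal_scale[OF assms(2), of "- 1"]] by (simp only:)
qed

lemma mem_coset: "g \<in> coset n f \<longleftrightarrow> g - f \<in> I n"
  unfolding op_coset_def by (auto simp: image_iff algebra_simps intro: bexI[of _ "g - f"])

lemma coset_self: "f \<in> coset n f"
  by (simp add: mem_coset ideal_zero)

lemma coset_nonempty: "coset n f \<noteq> {}"
  using coset_self by blast

lemma coset_eq_iff: "coset n f = coset n g \<longleftrightarrow> f - g \<in> I n"
proof
  assume "coset n f = coset n g"
  then show "f - g \<in> I n" using coset_self[of f n] by (simp add: mem_coset)
next
  assume *: "f - g \<in> I n"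
  show "coset n f = coset n g"
  proof (rule set_eqI)
    fix h
    show "h \<in> coset n f \<longleftrightarrow> h \<in> coset n g"
      using ideal_add[OF _ *, of "h - f"] ideal_diff[OF _ *, of "h - g"] by (auto simp: mem_coset)
  qed
qed

lemma coset_subset: "f \<in> free_space n \<Longrightarrow> coset n f \<subseteq> free_space n"
  using ideal_subset[of n] free_space_add[of f n] by (auto simp: op_coset_def)

text \<open>
  The operations of the quotient are unions over all representatives; each union collapses to one
  coset because another choice of representatives changes the result by an element of the ideal.
\<close>

lemma quotient_simps:
  "ops quotient n = coset n ` free_space n"
  "add_op quotient n (coset n f) (coset n g) = coset n (f + g)"
  "scale_op quotient n c (coset n f) = coset n (cscale c f)"
  "unit_op quotient = coset 1 (monom_of (Gen 1))"
proof -
  show "ops quotient n = coset n ` free_space n" "unit_op quotient = coset 1 (monom_of (Gen 1))"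
    by (simp_all add: quotient_operad_def)
  have "coset n (f' + g') = coset n (f + g)" if "f' \<in> coset n f" "g' \<in> coset n g" for f' g'
    using ideal_add[of "f' - f" n "g' - g"] that by (simp add: coset_eq_iff mem_coset algebra_simps)
  then show "add_op quotient n (coset n f) (coset n g) = coset n (f + g)"
    by (simp add: quotient_operad_def UN_constant_on coset_nonempty)
  have "coset n (cscale c f') = coset n (cscale c f)" if "f' \<in> coset n f" for f'
  proof -
    have "cscale c f' - cscale c f = cscale c (f' - f)" by (simp add: fun_eq_iff algebra_simps)
    then show ?thesis using ideal_scale[of "f' - f" n c] that by (simp add: coset_eq_iff mem_coset)
  qed
  then show "scale_op quotient n c (coset n f) = coset n (cscale c f)"
    by (simp add: quotient_operad_def UN_constant_on coset_nonempty)
qed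

lemma quotient_perm:
  assumes "\<sigma> permutes {1..n}"
  shows "perm_op quotient n \<sigma> (coset n f) = coset n (perm_op free_operad n \<sigma> f)"
proof -
  have "coset n (perm_op free_operad n \<sigma> f') = coset n (perm_op free_operad n \<sigma> f)"
    if "f' \<in> coset n f" for f'
    using ideal_perm[OF assms, of "f' - f"] that
    by (simp add: coset_eq_iff mem_coset perm_free_operad_diff)
  then show ?thesis by (simp add: quotient_operad_def UN_constant_on coset_nonempty)
qed

lemma quotient_comp:
  assumes i: "i \<in> {1..m}" and f: "f \<in> free_space m" and g: "g \<in> free_space n"
  shows "comp_op quotient m n i (coset m f) (coset n g) = coset (m + n - 1) (comp_op free_operad m n i f g)"
proof -
  have "coset (m + n - 1) (comp_op free_operad m n i f' g') =
      coset (m + n - 1) (comp_op free_operad m n i f g)"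
    if "f' \<in> coset m f" "g' \<in> coset n g" for f' g'
  proof -
    \<comment> \<open>Change one argument at a time, so that composition is used linearly in each of them.\<close>
    have "comp_op free_operad m n i (f' - f) g + comp_op free_operad m n i f' (g' - g) \<in> I (m + n - 1)"
      using that coset_subset[OF f] g by (intro ideal_add ideal_comp i) (auto simp: mem_coset)
    then show ?thesis by (simp add: coset_eq_iff comp_free_operad_diff)
  qed
  then show ?thesis by (simp add: quotient_operad_def UN_constant_on coset_nonempty)
qed

text \<open>
  The universal property of the quotient, in three parts: restriction along the projection, descent
  of a homomorphism constant on cosets, and uniqueness of the descended one. Descent is stated with
  equality on cosets rather than with a kernel because \<open>Q\<close> is arbitrary and need not have negatives.
\<close>

lemma pullback_hom:
  assumes "\<phi> \<in> operad_homs quotient Q"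
  shows "(\<lambda>n. \<lambda>f\<in>free_space n. \<phi> n (coset n f)) \<in> operad_homs free_operad Q"
proof -
  have unit: "monom_of (Gen 1) \<in> free_space 1"
    by (rule monom_of_in_free_space) (simp add: monomials_def)
  have \<phi>: "\<phi> n \<in> coset n ` free_space n \<rightarrow>\<^sub>E ops Q n"
    "f \<in> free_space n \<Longrightarrow> g \<in> free_space n \<Longrightarrow>
      \<phi> n (coset n (f + g)) = add_op Q n (\<phi> n (coset n f)) (\<phi> n (coset n g))"
    "f \<in> free_space n \<Longrightarrow> \<phi> n (coset n (cscale c f)) = scale_op Q n c (\<phi> n (coset n f))"
    "\<sigma> permutes {1..n} \<Longrightarrow> f \<in> free_space n \<Longrightarrow>
      \<phi> n (coset n (perm_op free_operad n \<sigma> f)) = perm_op Q n \<sigma> (\<phi> n (coset n f))"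
    "i \<in> {1..m} \<Longrightarrow> f \<in> free_space m \<Longrightarrow> g \<in> free_space n \<Longrightarrow>
      \<phi> (m + n - 1) (coset (m + n - 1) (comp_op free_operad m n i f g)) =
        comp_op Q m n i (\<phi> m (coset m f)) (\<phi> n (coset n g))"
    "\<phi> 1 (coset 1 (monom_of (Gen 1))) = unit_op Q" for n m f g c \<sigma> i
    using assms unfolding operad_homs_def
    by (force simp: quotient_simps quotient_perm[symmetric] quotient_comp[symmetric] simp del: One_nat_def)+
  show ?thesis
    unfolding operad_homs_def
    using \<phi>(1) by (auto simp: \<phi>(2-6) unit free_space_add free_space_cscale perm_in_free_space
        comp_in_free_space simp del: One_nat_def)
qed

lemma induced_hom:
  assumes \<psi>: "\<psi> \<in> operad_homs free_operad Q"
    and congruent: "\<And>n f g. f \<in> free_space n \<Longrightarrow> g \<in> free_space n \<Longrightarrow> f - g \<in> I n \<Longrightarrow> \<psi> n f = \<psi> n g"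
  obtains \<phi> where "\<phi> \<in> operad_homs quotient Q" "\<And>n f. f \<in> free_space n \<Longrightarrow> \<phi> n (coset n f) = \<psi> n f"
proof -
  define \<phi> where "\<phi> n = (\<lambda>A\<in>coset n ` free_space n. \<psi> n (SOME f. f \<in> free_space n \<and> coset n f = A))" for n
  have \<phi>: "\<phi> n (coset n f) = \<psi> n f" if "f \<in> free_space n" for n f
  proof -
    have "\<exists>g. g \<in> free_space n \<and> coset n g = coset n f" using that by blast
    from someI_ex[OF this] have "\<psi> n (SOME g. g \<in> free_space n \<and> coset n g = coset n f) = \<psi> n f"
      using that by (intro congruent) (auto simp: coset_eq_iff)
    then show ?thesis using that by (simp add: \<phi>_def)
  qed
  have unit: "monom_of (Gen 1) \<in> free_space 1"
    by (rule monom_of_in_free_space) (simp add: monomials_def)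
  have "\<phi> n \<in> coset n ` free_space n \<rightarrow>\<^sub>E ops Q n" for n
  proof (rule PiE_I)
    have "\<psi> n \<in> free_space n \<rightarrow>\<^sub>E ops Q n"
      using \<psi> by (simp add: operad_homs_def)
    then show "\<phi> n A \<in> ops Q n" if "A \<in> coset n ` free_space n" for A
      using that by (auto simp: \<phi> dest: PiE_mem)
  qed (simp add: \<phi>_def)
  then have "\<phi> \<in> operad_homs quotient Q"
    using \<psi> unfolding operad_homs_def
    by (auto simp: quotient_simps quotient_perm quotient_comp \<phi> unit free_space_add free_space_cscale
        perm_in_free_space comp_in_free_space simp del: One_nat_def)
  then show thesis using \<phi> by (rule that)
qed

lemma quotient_hom_eqI:
  assumes "\<phi> \<in> operad_homs quotient Q" "\<phi>' \<in> operad_homs quotient Q"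
    and "\<And>n f. f \<in> free_space n \<Longrightarrow> \<phi> n (coset n f) = \<phi>' n (coset n f)"
  shows "\<phi> = \<phi>'"
proof
  fix n
  have "\<phi> n \<in> coset n ` free_space n \<rightarrow>\<^sub>E ops Q n" "\<phi>' n \<in> coset n ` free_space n \<rightarrow>\<^sub>E ops Q n"
    using assms(1,2) by (auto simp: operad_homs_def quotient_simps)
  then show "\<phi> n = \<phi>' n" by (rule PiE_ext) (use assms(3) in auto)
qed

end

section \<open>Algebras over a binary quadratic operad\<close>

text \<open>
  An algebra structure composed with the projection is a homomorphism from the free operad, so it is
  the action of its own product; this gives injectivity and shows that \<open>R\<close> acts as zero. Conversely
  the kernel of the action of a product that satisfies \<open>R\<close> is an ideal containing \<open>R\<close>, so the action
  descends.
\<close>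

theorem algebra_product_bij_betw:
  fixes scale :: "'k::field \<Rightarrow> 'v::ab_group_add \<Rightarrow> 'v" and R :: "'k comb set"
  assumes V: "vector_space scale" and R: "R \<subseteq> free_space 3"
  shows "bij_betw (algebra_product R) (algebra_structures scale (binary_quadratic_operad R))
    {p. bilinear_product scale p \<and> (\<forall>f\<in>R. \<forall>x. comb_action scale p 3 f x = 0)}"
    (is "bij_betw _ ?A ?B")
proof -
  interpret free_operad_ideal "relation_ideal R"
    by unfold_locales (rule relation_ideal(1)[OF R])
  note alg = algebra_structures_def binary_quadratic_operad_def
  have gen: "(monom_of (Gen 1 \<odot> Gen 2) :: 'k comb) \<in> free_space 2"
    by (rule monom_of_in_free_space) (auto simp: monomials_def)
  have hom_action: "bilinear_product scale (algebra_product R \<phi>) \<and>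
      (\<forall>n. \<forall>f\<in>free_space n. \<phi> n (coset n f) = comb_action scale (algebra_product R \<phi>) n f)"
    if "\<phi> \<in> ?A" for \<phi>
  proof -
    have "(\<lambda>n. \<lambda>f\<in>free_space n. \<phi> n (coset n f)) \<in> operad_homs free_operad (End_operad scale)"
      using that unfolding alg by (rule pullback_hom)
    note * = free_hom_is_comb_action[OF this]
    have p: "(\<lambda>a b. (\<lambda>f\<in>free_space 2. \<phi> 2 (coset 2 f)) (monom_of (Gen 1 \<odot> Gen 2))
        (\<lambda>j. if j = 1 then a else b)) = algebra_product R \<phi>"
      using gen by (simp add: algebra_product_def fun_eq_iff)
    show ?thesis
      using *(1)[OF gen] *(2) unfolding p by simp
  qed
  have "inj_on (algebra_product R) ?A"
  proof
    fix \<phi> \<phi>' assume "\<phi> \<in> ?A" "\<phi>' \<in> ?A" "algebra_product R \<phi> = algebra_product R \<phi>'"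
    then show "\<phi> = \<phi>'"
      using hom_action[of \<phi>] hom_action[of \<phi>'] quotient_hom_eqI[of \<phi> "End_operad scale" \<phi>']
      unfolding alg by simp
  qed
  moreover have "algebra_product R ` ?A = ?B"
  proof (intro equalityI subsetI)
    fix p assume "p \<in> algebra_product R ` ?A"
    then obtain \<phi> where \<phi>: "\<phi> \<in> ?A" and p: "p = algebra_product R \<phi>" by blast
    have "comb_action scale p 3 f x = 0" if f: "f \<in> R" for f x
    proof -
      have "coset 3 f = coset 3 0"
        using f relation_ideal(2)[OF R] by (auto simp: coset_eq_iff)
      then have "comb_action scale p 3 f = comb_action scale p 3 0"
        using hom_action[OF \<phi>] f R free_space_zero[of 3] unfolding p by (metis subsetD)
      then show ?thesis by (simp add: comb_action_linear(1)[OF V])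
    qed
    then show "p \<in> ?B" using hom_action[OF \<phi>] p by simp
  next
    fix p assume "p \<in> ?B"
    then have B: "bilinear_product scale p" and zero: "\<And>f x. f \<in> R \<Longrightarrow> comb_action scale p 3 f x = 0"
      by auto
    let ?\<psi> = "\<lambda>n. restrict (comb_action scale p n) (free_space n)"
    note \<psi> = comb_action_hom[OF B]
    have "relation_ideal R \<le> (\<lambda>n. {f \<in> free_space n. ?\<psi> n f = (\<lambda>x. 0)})"
      unfolding relation_ideal_def
      by (intro generated_ideal_least free_hom_kernel_ideal[OF V \<psi>])
        (use zero R in \<open>auto simp: le_fun_def\<close>)
    then have kill: "comb_action scale p n f = (\<lambda>x. 0)" if "f \<in> relation_ideal R n" for n f
      using that le_funD[of "relation_ideal R" "\<lambda>n. {f \<in> free_space n. ?\<psi> n f = (\<lambda>x. 0)}" n] by auto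
    have "?\<psi> n f = ?\<psi> n g" if "f \<in> free_space n" "g \<in> free_space n" "f - g \<in> relation_ideal R n" for n f g
      using kill[OF that(3)] that(1,2) by (simp add: fun_eq_iff comb_action_linear(3)[OF V])
    then obtain \<phi> where \<phi>: "\<phi> \<in> operad_homs quotient (End_operad scale)"
      and eq: "\<And>n f. f \<in> free_space n \<Longrightarrow> \<phi> n (coset n f) = ?\<psi> n f"
      by (rule induced_hom[OF \<psi>]) blast+
    have "Gen 1 \<odot> Gen 2 \<in> monomials 2" by (auto simp: monomials_def)
    then have "algebra_product R \<phi> = p"
      unfolding algebra_product_def eq[OF gen] using gen
      by (simp add: fun_eq_iff comb_action_monom_of[OF V])
    then show "p \<in> algebra_product R ` ?A" using \<phi> unfolding alg by blast
  qed
  ultimately show ?thesis unfolding bij_betw_def by blast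
qed

section \<open>The arity 3 component of the free operad\<close>

lemma length_leaves_eq_1: "length (leaves t) = 1 \<Longrightarrow> \<exists>i. t = Gen i"
proof (cases t)
  case (Prod r s)
  have "length (leaves r) \<noteq> 0" "length (leaves s) \<noteq> 0" by simp_all
  then show "length (leaves t) = 1 \<Longrightarrow> \<exists>i. t = Gen i" unfolding Prod leaves.simps length_append by linarith
qed simp

text \<open>
  The shape of a monomial of arity 3 follows by counting leaves: the two factors have one and two
  leaves in one of the two orders.
\<close>

lemma monomials_3_cases [consumes 1, case_names left right]:
  assumes "t \<in> monomials 3"
  obtains (left) i j k where "t = Gen i \<odot> Gen j \<odot> Gen k" "{i, j, k} = {1..3}"
  | (right) i j k where "t = Gen i \<odot> (Gen j \<odot> Gen k)" "{i, j, k} = {1..3}"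
proof -
  have set: "set (leaves t) = {1..3}" and len: "length (leaves t) = 3"
    using assms distinct_card[of "leaves t"] by (auto simp: monomials_def)
  from len obtain r s where t: "t = r \<odot> s" by (cases t) auto
  have pos: "length (leaves r) \<noteq> 0" "length (leaves s) \<noteq> 0" by simp_all
  have sum: "length (leaves r) + length (leaves s) = 3" using len t by simp
  show thesis
  proof (cases r)
    case (Gen i)
    then have s2: "length (leaves s) = 2" using sum by simp
    then obtain u v where s: "s = u \<odot> v" by (cases s) auto
    have "length (leaves u) \<noteq> 0" "length (leaves v) \<noteq> 0" by simp_all
    then have "length (leaves u) = 1" "length (leaves v) = 1"
      using s2 unfolding s leaves.simps length_append by linarith+
    then obtain j k where "u = Gen j" "v = Gen k" using length_leaves_eq_1 by metis
    then show thesis using right[of i j k] set t s Gen by (simp add: insert_commute)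
  next
    case (Prod u v)
    have "length (leaves u) \<noteq> 0" "length (leaves v) \<noteq> 0" by simp_all
    then have "length (leaves u) = 1" "length (leaves v) = 1" "length (leaves s) = 1"
      using sum pos unfolding Prod leaves.simps length_append by linarith+
    then obtain i j k where "u = Gen i" "v = Gen j" "s = Gen k" using length_leaves_eq_1 by metis
    then show thesis using left[of i j k] set t Prod by (simp add: insert_commute)
  qed
qed

lemma atLeastAtMost_1_3: "{1..3 :: nat} = {1, 2, 3}"
  by auto

lemma monomials_3I:
  assumes "{i, j, k} = {1..3}"
  shows "Gen i \<odot> Gen j \<odot> Gen k \<in> monomials 3" "Gen i \<odot> (Gen j \<odot> Gen k) \<in> monomials 3"
proof -
  have "card {i, j, k} = 3" using assms by simp
  then have "i \<noteq> j" "i \<noteq> k" "j \<noteq> k" by (auto simp: card_insert_if split: if_splits)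
  then show "Gen i \<odot> Gen j \<odot> Gen k \<in> monomials 3" "Gen i \<odot> (Gen j \<odot> Gen k) \<in> monomials 3"
    using assms by (simp_all add: monomials_def insert_commute)
qed

lemma arrangements_1_3:
  assumes "{i, j, k} = {1..3 :: nat}"
  shows "(i, j, k) \<in> {(1, 2, 3), (1, 3, 2), (2, 1, 3), (3, 1, 2), (2, 3, 1), (3, 2, 1)}"
proof -
  have "i \<in> {1, 2, 3}" "j \<in> {1, 2, 3}" "k \<in> {1, 2, 3}"
    using assms unfolding atLeastAtMost_1_3 by blast+
  moreover have "i \<noteq> j \<and> i \<noteq> k \<and> j \<noteq> k"
    using monomials_3I(1)[OF assms] by (auto simp: monomials_def)
  ultimately show ?thesis by auto
qed

lemma perm3_simps [simp]: "perm3 i j k 1 = i" "perm3 i j k (Suc 0) = i" "perm3 i j k 2 = j" "perm3 i j k 3 = k"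
  by (simp_all add: perm3_def)

lemma perm3_permutes:
  assumes "{i, j, k} = {1..3}"
  shows "perm3 i j k permutes {1..3}"
proof (rule bij_imp_permutes)
  have "perm3 i j k ` {1..3} = {1..3}"
    unfolding assms[symmetric] by (simp add: assms atLeastAtMost_1_3 del: One_nat_def)
  then show "bij_betw (perm3 i j k) {1..3} {1..3}"
    by (simp add: bij_betw_def eq_card_imp_inj_on)
qed (auto simp: perm3_def)

lemma permutes_eq_perm3:
  assumes "\<sigma> permutes {1..3}"
  shows "perm3 (\<sigma> 1) (\<sigma> 2) (\<sigma> 3) = \<sigma>"
proof
  fix x
  have "x = 1 \<or> x = 2 \<or> x = 3 \<or> x \<notin> {1..3 :: nat}" by auto
  then show "perm3 (\<sigma> 1) (\<sigma> 2) (\<sigma> 3) x = \<sigma> x"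
    using permutes_not_in[OF assms, of x] by (auto simp: perm3_def)
qed

lemma perm3_compose:
  assumes "\<sigma> permutes {1..3}"
  shows "perm3 (\<sigma> i) (\<sigma> j) (\<sigma> k) = \<sigma> \<circ> perm3 i j k"
proof
  fix x
  have "x = 1 \<or> x = 2 \<or> x = 3 \<or> x \<notin> {1..3 :: nat}" by auto
  then show "perm3 (\<sigma> i) (\<sigma> j) (\<sigma> k) x = (\<sigma> \<circ> perm3 i j k) x"
    using permutes_not_in[OF assms, of x] by (auto simp: perm3_def)
qed

lemma pairing_sign_map:
  assumes \<sigma>: "\<sigma> permutes {1..3}" and t: "t \<in> monomials 3"
  shows "pairing_sign (map_monomial \<sigma> t) = sign \<sigma> * pairing_sign t"
proof -
  have "sign (perm3 (\<sigma> i) (\<sigma> j) (\<sigma> k)) = sign \<sigma> * sign (perm3 i j k)" if "{i, j, k} = {1..3}" for i j k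
    unfolding perm3_compose[OF \<sigma>] using \<sigma> perm3_permutes[OF that]
    by (intro sign_compose permutes_imp_permutation[of "{1..3}"]) auto
  with t show ?thesis by (cases rule: monomials_3_cases) auto
qed

lemma pairing_sign_square:
  assumes "t \<in> monomials 3"
  shows "of_int (pairing_sign t) * of_int (pairing_sign t) = (1 :: 'a::ring_1)"
proof -
  have "pairing_sign t * pairing_sign t = 1"
    using assms by (cases rule: monomials_3_cases) auto
  then show ?thesis by (metis of_int_1 of_int_mult)
qed

section \<open>The orthogonal of the Lie-admissible relation\<close>

text \<open>
  Exactly one permutation contributes to the coefficient of a given monomial, the one listing its
  labels from left to right.
\<close>

lemma lie_adm_element_apply:
  assumes "t \<in> monomials 3"
  shows "lie_adm_element t = (of_int (pairing_sign t) :: 'k::field)"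
proof -
  have eq: "i = \<sigma> 1 \<and> j = \<sigma> 2 \<and> k = \<sigma> 3 \<longleftrightarrow> \<sigma> = perm3 i j k" if "\<sigma> permutes {1..3}" for \<sigma> i j k
    using permutes_eq_perm3[OF that] by (metis perm3_simps(1,3,4))
  show ?thesis
    using assms
  proof (cases rule: monomials_3_cases)
    case (left i j k)
    have "lie_adm_element t =
        (\<Sum>\<sigma> | \<sigma> permutes {1..3}. if \<sigma> = perm3 i j k then - of_int (sign \<sigma>) else (0 :: 'k))"
      unfolding lie_adm_element_def sum_comb_apply
    proof (rule sum.cong[OF refl])
      fix \<sigma> :: "nat \<Rightarrow> nat" assume "\<sigma> \<in> {\<sigma>. \<sigma> permutes {1..3}}"
      then have "\<sigma> permutes {1..3}" by simp
      from eq[OF this, of i j k] show "cscale (of_int (sign \<sigma>)) (monom_of (Gen (\<sigma> 1) \<odot> (Gen (\<sigma> 2) \<odot> Gen (\<sigma> 3))) -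
            monom_of (Gen (\<sigma> 1) \<odot> Gen (\<sigma> 2) \<odot> Gen (\<sigma> 3))) t =
          (if \<sigma> = perm3 i j k then - of_int (sign \<sigma>) else (0 :: 'k))"
        by (auto simp: left monom_of_apply simp del: One_nat_def)
    qed
    then show ?thesis
      using left perm3_permutes[OF left(2)] by (simp add: finite_permutations)
  next
    case (right i j k)
    have "lie_adm_element t =
        (\<Sum>\<sigma> | \<sigma> permutes {1..3}. if \<sigma> = perm3 i j k then of_int (sign \<sigma>) else (0 :: 'k))"
      unfolding lie_adm_element_def sum_comb_apply
    proof (rule sum.cong[OF refl])
      fix \<sigma> :: "nat \<Rightarrow> nat" assume "\<sigma> \<in> {\<sigma>. \<sigma> permutes {1..3}}"
      then have "\<sigma> permutes {1..3}" by simp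
      from eq[OF this, of i j k] show "cscale (of_int (sign \<sigma>)) (monom_of (Gen (\<sigma> 1) \<odot> (Gen (\<sigma> 2) \<odot> Gen (\<sigma> 3))) -
            monom_of (Gen (\<sigma> 1) \<odot> Gen (\<sigma> 2) \<odot> Gen (\<sigma> 3))) t =
          (if \<sigma> = perm3 i j k then of_int (sign \<sigma>) else (0 :: 'k))"
        by (auto simp: right monom_of_apply simp del: One_nat_def)
    qed
    then show ?thesis
      using right perm3_permutes[OF right(2)] by (simp add: finite_permutations)
  qed
qed

lemma lie_adm_element_in_free_space: "lie_adm_element \<in> free_space 3"
proof -
  have "{\<sigma> 1, \<sigma> 2, \<sigma> 3} = {1..3}" if "\<sigma> permutes {1..3 :: nat}" for \<sigma>
    using permutes_image[OF that] by (simp add: atLeastAtMost_1_3 del: One_nat_def)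
  then show ?thesis
    unfolding lie_adm_element_def
    by (intro free_space_sum free_space_cscale free_space_diff monom_of_in_free_space monomials_3I) auto
qed

lemma sigma3_submoduleI:
  assumes "R \<subseteq> free_space 3" "0 \<in> R" "\<And>f g. f \<in> R \<Longrightarrow> g \<in> R \<Longrightarrow> f + g \<in> R"
    "\<And>c f. f \<in> R \<Longrightarrow> cscale c f \<in> R"
    "\<And>\<sigma> f. \<sigma> permutes {1..3} \<Longrightarrow> f \<in> R \<Longrightarrow> perm_op free_operad 3 \<sigma> f \<in> R"
  shows "sigma3_submodule R"
proof -
  interpret vector_space "cscale :: 'a \<Rightarrow> _" by (rule vector_space_cscale)
  show ?thesis using assms unfolding sigma3_submodule_def subspace_def by blast
qed

lemma sigma3_submoduleD:
  assumes "sigma3_submodule R"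
  shows "0 \<in> R" "f \<in> R \<Longrightarrow> g \<in> R \<Longrightarrow> f + g \<in> R" "f \<in> R \<Longrightarrow> cscale c f \<in> R"
    "\<sigma> permutes {1..3} \<Longrightarrow> f \<in> R \<Longrightarrow> perm_op free_operad 3 \<sigma> f \<in> R"
proof -
  interpret vector_space "cscale :: 'a \<Rightarrow> _" by (rule vector_space_cscale)
  show "0 \<in> R" "f \<in> R \<Longrightarrow> g \<in> R \<Longrightarrow> f + g \<in> R" "f \<in> R \<Longrightarrow> cscale c f \<in> R"
    "\<sigma> permutes {1..3} \<Longrightarrow> f \<in> R \<Longrightarrow> perm_op free_operad 3 \<sigma> f \<in> R"
    using assms unfolding sigma3_submodule_def subspace_def by auto
qed

text \<open>
  A permutation multiplies the Lie-admissible element by its sign, so the line it spans is already a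
  submodule.
\<close>

lemma lie_adm_relations_multiple:
  fixes f :: "'k::field comb"
  assumes "f \<in> lie_adm_relations"
  obtains c where "\<And>t. t \<in> monomials 3 \<Longrightarrow> f t = c * of_int (pairing_sign t)"
proof -
  let ?W = "{f \<in> free_space 3. \<exists>c :: 'k. \<forall>t\<in>monomials 3. f t = c * of_int (pairing_sign t)}"
  have "sigma3_submodule ?W"
  proof (rule sigma3_submoduleI)
    fix f g :: "'k comb" assume "f \<in> ?W" "g \<in> ?W"
    then obtain c d where "\<forall>t\<in>monomials 3. f t = c * of_int (pairing_sign t)"
      "\<forall>t\<in>monomials 3. g t = d * of_int (pairing_sign t)" by blast
    then have "\<forall>t\<in>monomials 3. (f + g) t = (c + d) * of_int (pairing_sign t)"
      by (simp add: algebra_simps)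
    then show "f + g \<in> ?W" using \<open>f \<in> ?W\<close> \<open>g \<in> ?W\<close> free_space_add by blast
  next
    fix c and f :: "'k comb" assume "f \<in> ?W"
    then obtain d where "\<forall>t\<in>monomials 3. f t = d * of_int (pairing_sign t)" by blast
    then have "\<forall>t\<in>monomials 3. cscale c f t = (c * d) * of_int (pairing_sign t)" by simp
    then show "cscale c f \<in> ?W" using \<open>f \<in> ?W\<close> free_space_cscale by blast
  next
    fix \<sigma> and f :: "'k comb" assume \<sigma>: "\<sigma> permutes {1..3 :: nat}" and "f \<in> ?W"
    then obtain c where c: "\<forall>t\<in>monomials 3. f t = c * of_int (pairing_sign t)" by blast
    have "perm_op free_operad 3 \<sigma> f t = (c * of_int (sign \<sigma>)) * of_int (pairing_sign t)"
      if t: "t \<in> monomials 3" for t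
    proof -
      let ?s = "map_monomial (inv \<sigma>) t"
      have s: "?s \<in> monomials 3" by (rule map_monomial_in_monomials[OF permutes_inv[OF \<sigma>] t])
      have t': "map_monomial \<sigma> ?s = t" by (rule map_monomial_inv(1)[OF \<sigma>])
      have "pairing_sign ?s = sign \<sigma> * pairing_sign t"
        using pairing_sign_map[OF \<sigma> s] t' by simp
      then show ?thesis
        using perm_apply_map[OF \<sigma> s, of f] c s t' by (simp add: mult.assoc)
    qed
    then show "perm_op free_operad 3 \<sigma> f \<in> ?W" using perm_in_free_space[OF \<sigma>] by blast
  qed (auto intro: exI[of _ 0])
  moreover have "\<forall>t\<in>monomials 3. lie_adm_element t = (1 :: 'k) * of_int (pairing_sign t)"
    by (simp add: lie_adm_element_apply)
  then have "lie_adm_element \<in> ?W"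
    using lie_adm_element_in_free_space by blast
  ultimately have "lie_adm_relations \<subseteq> ?W"
    unfolding lie_adm_relations_def by (intro hull_minimal) auto
  then show thesis using assms that by blast
qed

text \<open>
  Signs square to one, so pairing with the Lie-admissible element forgets them and leaves the sum of
  the coefficients.
\<close>

lemma orthogonal_lie_adm:
  "orthogonal_relations (lie_adm_relations :: 'k::field comb set) =
    {g \<in> free_space 3. (\<Sum>t\<in>monomials 3. g t) = 0}"
proof -
  have pairing: "pairing f g = c * (\<Sum>t\<in>monomials 3. g t)"
    if "\<And>t. t \<in> monomials 3 \<Longrightarrow> f t = c * of_int (pairing_sign t)" for f g :: "'k comb" and c
  proof -
    have "of_int (pairing_sign t) * f t * g t = c * g t" if "t \<in> monomials 3" for t
      using pairing_sign_square[OF that, where 'a = 'k] \<open>\<And>t. t \<in> monomials 3 \<Longrightarrow> f t = _ t\<close>[OF that]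
      by (metis mult.commute mult.left_commute mult_1)
    then show ?thesis unfolding pairing_def sum_distrib_left by (intro sum.cong) auto
  qed
  have "lie_adm_element \<in> lie_adm_relations"
    unfolding lie_adm_relations_def by (rule hull_inc) simp
  moreover have "pairing lie_adm_element g = (\<Sum>t\<in>monomials 3. g t)" for g :: "'k comb"
    using pairing[of lie_adm_element 1 g] by (simp add: lie_adm_element_apply)
  moreover have "pairing f g = 0" if "f \<in> lie_adm_relations" "(\<Sum>t\<in>monomials 3. g t) = 0"
    for f g :: "'k comb"
    using lie_adm_relations_multiple[OF that(1)] pairing that(2) by (metis mult_zero_right)
  ultimately show ?thesis unfolding orthogonal_relations_def by force
qed

section \<open>The relations of 3-order abelian associative algebras\<close>

abbreviation assoc_abelian_generators :: "'k::field comb set" where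
  "assoc_abelian_generators \<equiv>
     {monom_of (Gen 1 \<odot> Gen 2 \<odot> Gen 3) - monom_of (Gen 1 \<odot> (Gen 2 \<odot> Gen 3)),
      monom_of (Gen 1 \<odot> Gen 2 \<odot> Gen 3) - monom_of (Gen 1 \<odot> Gen 3 \<odot> Gen 2),
      monom_of (Gen 1 \<odot> Gen 2 \<odot> Gen 3) - monom_of (Gen 2 \<odot> Gen 1 \<odot> Gen 3)}"

text \<open>
  The translates of the first generator compare the two bracketings of a word. Those of the other two
  exchange neighbouring letters of a left-bracketed word, and such exchanges connect all six orders.
\<close>

lemma monom_diff_in_submodule:
  fixes S :: "'k::field comb set"
  assumes S: "sigma3_submodule S" "assoc_abelian_generators \<subseteq> S" and t: "t \<in> monomials 3"
  shows "monom_of t - monom_of (Gen 1 \<odot> Gen 2 \<odot> Gen 3) \<in> S"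
proof -
  define E where "E s t \<longleftrightarrow> (monom_of s - monom_of t :: 'k comb) \<in> S" for s t
  have trans: "E r t" if "E r s" "E s t" for r s t
  proof -
    have "monom_of r - monom_of t = (monom_of r - monom_of s) + (monom_of s - monom_of t :: 'k comb)" by simp
    then show ?thesis using sigma3_submoduleD(2)[OF S(1)] that unfolding E_def by metis
  qed
  have sym: "E t s" if "E s t" for s t
  proof -
    have "monom_of t - monom_of s = cscale (- 1) (monom_of s - monom_of t :: 'k comb)"
      by (simp add: fun_eq_iff)
    then show ?thesis using sigma3_submoduleD(3)[OF S(1), of _ "- 1"] that unfolding E_def by simp
  qed
  have perm: "E (map_monomial \<sigma> s) (map_monomial \<sigma> t)"
    if "E s t" "\<sigma> permutes {1..3}" "s \<in> monomials 3" "t \<in> monomials 3" for \<sigma> s t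
    using sigma3_submoduleD(4)[OF S(1) that(2) that(1)[unfolded E_def]] that(3,4)
    by (simp add: E_def perm_free_operad_diff perm_monom_of)
  have ex: "{1, 2, 3 :: nat} = {1..3}" "{1, 3, 2 :: nat} = {1..3}" "{2, 1, 3 :: nat} = {1..3}" by auto
  have base: "E (Gen 1 \<odot> Gen 2 \<odot> Gen 3) (Gen 1 \<odot> (Gen 2 \<odot> Gen 3))"
    "E (Gen 1 \<odot> Gen 2 \<odot> Gen 3) (Gen 1 \<odot> Gen 3 \<odot> Gen 2)"
    "E (Gen 1 \<odot> Gen 2 \<odot> Gen 3) (Gen 2 \<odot> Gen 1 \<odot> Gen 3)"
    using S(2) unfolding E_def by auto
  have moves: "E (Gen i \<odot> Gen j \<odot> Gen k) (Gen i \<odot> (Gen j \<odot> Gen k))"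
    "E (Gen i \<odot> Gen j \<odot> Gen k) (Gen i \<odot> Gen k \<odot> Gen j)"
    "E (Gen i \<odot> Gen j \<odot> Gen k) (Gen j \<odot> Gen i \<odot> Gen k)"
    if "{i, j, k} = {1..3}" for i j k
    using perm[OF base(1) perm3_permutes[OF that]] perm[OF base(2) perm3_permutes[OF that]]
      perm[OF base(3) perm3_permutes[OF that]] monomials_3I[OF ex(1)] monomials_3I[OF ex(2)]
      monomials_3I[OF ex(3)]
    by simp_all
  let ?t0 = "Gen 1 \<odot> Gen 2 \<odot> Gen 3 :: nat monomial"
  have left_combs: "E (Gen i \<odot> Gen j \<odot> Gen k) ?t0" if ijk: "{i, j, k} = {1..3}" for i j k
  proof -
    have "E ?t0 ?t0" using base(2) sym trans by blast
    moreover have E132: "E (Gen 1 \<odot> Gen 3 \<odot> Gen 2) ?t0" and E213: "E (Gen 2 \<odot> Gen 1 \<odot> Gen 3) ?t0"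
      using base(2,3) by (auto intro: sym)
    moreover have E312: "E (Gen 3 \<odot> Gen 1 \<odot> Gen 2) ?t0"
      by (rule trans[OF moves(3) E132]) auto
    moreover have "E (Gen 2 \<odot> Gen 3 \<odot> Gen 1) ?t0" by (rule trans[OF moves(2) E213]) auto
    moreover have "E (Gen 3 \<odot> Gen 2 \<odot> Gen 1) ?t0" by (rule trans[OF moves(2) E312]) auto
    ultimately show ?thesis using arrangements_1_3[OF ijk] by auto
  qed
  show ?thesis
    using t
  proof (cases rule: monomials_3_cases)
    case (left i j k)
    then show ?thesis using left_combs unfolding E_def by blast
  next
    case (right i j k)
    then show ?thesis using trans[OF sym[OF moves(1)] left_combs] unfolding E_def by blast
  qed
qed

text \<open>
  The hyperplane of combinations with coefficient sum zero is a submodule containing the generators.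
  Conversely, when the coefficients of \<open>g\<close> sum to zero, \<open>g\<close> is unchanged if one fixed monomial is
  subtracted from every monomial in its expansion. Membership is checked in each submodule of which
  the hull is the intersection.
\<close>

lemma assoc_abelian_relations_eq:
  "(assoc_abelian_relations :: 'k::field comb set) = {g \<in> free_space 3. (\<Sum>t\<in>monomials 3. g t) = 0}"
    (is "_ = ?Z")
proof (intro equalityI subsetI)
  have ex: "{1, 2, 3 :: nat} = {1..3}" "{1, 3, 2 :: nat} = {1..3}" "{2, 1, 3 :: nat} = {1..3}" by auto
  have "sigma3_submodule ?Z"
  proof (rule sigma3_submoduleI)
    fix \<sigma> and f :: "'k comb" assume \<sigma>: "\<sigma> permutes {1..3 :: nat}" and f: "f \<in> ?Z"
    have "(\<Sum>t\<in>monomials 3. perm_op free_operad 3 \<sigma> f t) = (\<Sum>t\<in>monomials 3. f t)"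
      by (rule sum.reindex_bij_witness[of _ "map_monomial \<sigma>" "map_monomial (inv \<sigma>)"])
        (auto simp: map_monomial_inv[OF \<sigma>] map_monomial_in_monomials[OF \<sigma>]
          map_monomial_in_monomials[OF permutes_inv[OF \<sigma>]] perm_apply_map[OF \<sigma>, symmetric])
    then show "perm_op free_operad 3 \<sigma> f \<in> ?Z" using f perm_in_free_space[OF \<sigma>] by simp
  qed (auto simp: free_space_add free_space_cscale sum.distrib sum_distrib_left[symmetric])
  moreover have "monom_of s - monom_of t \<in> ?Z" if "s \<in> monomials 3" "t \<in> monomials 3" for s t
    using that by (auto simp: free_space_diff monom_of_in_free_space sum_subtractf monom_of_apply)
  then have "assoc_abelian_generators \<subseteq> ?Z"
    using monomials_3I[OF ex(1)] monomials_3I[OF ex(2)] monomials_3I[OF ex(3)]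
    unfolding insert_subset by blast
  ultimately show "g \<in> ?Z" if "g \<in> assoc_abelian_relations" for g
    using that hull_minimal unfolding assoc_abelian_relations_def by blast
next
  fix g :: "'k comb" assume g: "g \<in> ?Z"
  let ?t0 = "Gen 1 \<odot> Gen 2 \<odot> Gen 3 :: nat monomial"
  have "g \<in> S" if S: "sigma3_submodule S" "assoc_abelian_generators \<subseteq> S" for S
  proof -
    have partial: "(\<Sum>t\<in>T. cscale (g t) (monom_of t - monom_of ?t0)) \<in> S" if "T \<subseteq> monomials 3" for T
      using that
      by (induction T rule: infinite_finite_induct)
        (auto intro!: sigma3_submoduleD[OF S(1)] monom_diff_in_submodule[OF S] simp del: One_nat_def)
    have g_eq: "g = (\<Sum>t\<in>monomials 3. cscale (g t) (monom_of t - monom_of ?t0))"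
    proof
      fix s
      have "(\<Sum>t\<in>monomials 3. cscale (g t) (monom_of t - monom_of ?t0)) s =
          (\<Sum>t\<in>monomials 3. cscale (g t) (monom_of t)) s - (\<Sum>t\<in>monomials 3. g t) * monom_of ?t0 s"
        by (simp add: sum_comb_apply algebra_simps sum_subtractf sum_distrib_right)
      then show "g s = (\<Sum>t\<in>monomials 3. cscale (g t) (monom_of t - monom_of ?t0)) s"
        using g free_space_expansion[of g 3] by simp
    qed
    show ?thesis by (subst g_eq) (rule partial[OF order_refl])
  qed
  then show "g \<in> assoc_abelian_relations"
    unfolding assoc_abelian_relations_def hull_def by blast
qed

text \<open>
  The combinations acting as zero form a submodule, so only the three generators have to be tested.
\<close>

lemma assoc_abelian_action_zero_iff:
  fixes scale :: "'k::field \<Rightarrow> 'v::ab_group_add \<Rightarrow> 'v"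
  assumes V: "vector_space scale"
  shows "(\<forall>f\<in>assoc_abelian_relations. \<forall>x. comb_action scale p 3 f x = 0) \<longleftrightarrow>
    associative_product p \<and> (\<forall>a b c. p (p a b) c = p (p a c) b \<and> p (p a c) b = p (p b a) c)"
    (is "?L \<longleftrightarrow> ?R")
proof -
  interpret vector_space scale by fact
  have ex: "{1, 2, 3 :: nat} = {1..3}" "{1, 3, 2 :: nat} = {1..3}" "{2, 1, 3 :: nat} = {1..3}" by auto
  have diff: "comb_action scale p 3 (monom_of s - monom_of t) x = eval_monomial p x s - eval_monomial p x t"
    if "s \<in> monomials 3" "t \<in> monomials 3" for s t x
    using that by (simp add: comb_action_linear(3)[OF V] comb_action_monom_of[OF V])
  have gens: "(\<forall>f\<in>assoc_abelian_generators. comb_action scale p 3 f x = 0) \<longleftrightarrow>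
      p (p (x 1) (x 2)) (x 3) = p (x 1) (p (x 2) (x 3)) \<and>
      p (p (x 1) (x 2)) (x 3) = p (p (x 1) (x 3)) (x 2) \<and>
      p (p (x 1) (x 2)) (x 3) = p (p (x 2) (x 1)) (x 3)" for x
    using monomials_3I[OF ex(1)] monomials_3I[OF ex(2)] monomials_3I[OF ex(3)] by (simp add: diff)
  show ?thesis
  proof
    assume L: ?L
    have "p (p a b) c = p a (p b c) \<and> p (p a b) c = p (p a c) b \<and> p (p a b) c = p (p b a) c" for a b c
    proof -
      have "assoc_abelian_generators \<subseteq> (assoc_abelian_relations :: 'k comb set)"
        unfolding assoc_abelian_relations_def by (rule hull_subset)
      then show ?thesis
        using L gens[of "\<lambda>j. if j = 1 then a else if j = 2 then b else c"] by auto
    qed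
    then show ?R unfolding associative_product_def by metis
  next
    assume R: ?R
    let ?K = "{f \<in> free_space 3. \<forall>x. comb_action scale p 3 f x = 0}"
    have "sigma3_submodule ?K"
      by (rule sigma3_submoduleI)
        (auto simp: comb_action_linear[OF V] comb_action_perm[OF V] free_space_add free_space_cscale
          perm_in_free_space)
    moreover have "assoc_abelian_generators \<subseteq> free_space 3"
      using monomials_3I[OF ex(1)] monomials_3I[OF ex(2)] monomials_3I[OF ex(3)]
      by (simp add: free_space_diff monom_of_in_free_space)
    moreover have "p (p a b) c = p a (p b c)" "p (p a b) c = p (p a c) b" "p (p a b) c = p (p b a) c"
      for a b c
      using R unfolding associative_product_def by metis+
    then have "\<forall>f\<in>assoc_abelian_generators. comb_action scale p 3 f x = 0" for x
      unfolding gens by (intro conjI)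
    ultimately have "sigma3_submodule ?K" "assoc_abelian_generators \<subseteq> ?K"
      by blast+
    then have "assoc_abelian_relations \<subseteq> ?K"
      unfolding assoc_abelian_relations_def by (intro hull_minimal)
    then show ?L by blast
  qed
qed

lemma three_order_abelian_iff:
  fixes p :: "'a \<Rightarrow> 'a \<Rightarrow> 'a"
  shows "(\<forall>a b c. p (p a b) c = p (p a c) b \<and> p (p a c) b = p (p b a) c) \<longleftrightarrow> three_order_abelian p"
proof
  assume *: "\<forall>a b c. p (p a b) c = p (p a c) b \<and> p (p a c) b = p (p b a) c"
  show "three_order_abelian p"
    unfolding three_order_abelian_def
  proof (intro allI impI)
    fix \<sigma> :: "nat \<Rightarrow> nat" and X :: "nat \<Rightarrow> 'a"
    assume \<sigma>: "\<sigma> permutes {1..3}"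
    have "{\<sigma> 1, \<sigma> 2, \<sigma> 3} = {1..3}"
      using permutes_image[OF \<sigma>] by (simp add: atLeastAtMost_1_3 del: One_nat_def)
    note arrangement = arrangements_1_3[OF this]
    define q where "q i j k = p (p (X i) (X j)) (X k)" for i j k
    have swap: "q i j k = q i k j" "q i j k = q j i k" for i j k
      unfolding q_def using * by metis+
    have "q 1 3 2 = q 1 2 3" "q 2 1 3 = q 1 2 3"
      by (rule swap)+
    moreover from this have "q 3 1 2 = q 1 2 3" "q 2 3 1 = q 1 2 3"
      using swap(2)[of 3 1 2] swap(1)[of 2 3 1] by simp_all
    moreover from this have "q 3 2 1 = q 1 2 3"
      using swap(1)[of 3 2 1] by simp
    ultimately have "q 1 2 3 = q (\<sigma> 1) (\<sigma> 2) (\<sigma> 3)"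
      using arrangement by (auto simp del: One_nat_def)
    then show "p (p (X 1) (X 2)) (X 3) = p (p (X (\<sigma> 1)) (X (\<sigma> 2))) (X (\<sigma> 3))"
      by (simp only: q_def)
  qed
next
  assume *: "three_order_abelian p"
  have swap: "p (p (X 1) (X 2)) (X 3) = p (p (X i) (X j)) (X k)" if "{i, j, k} = {1..3}" for X :: "nat \<Rightarrow> 'a" and i j k
    using *[unfolded three_order_abelian_def, rule_format, OF perm3_permutes[OF that], of X] by simp
  have ex: "{1, 3, 2 :: nat} = {1..3}" "{2, 1, 3 :: nat} = {1..3}" by auto
  show "\<forall>a b c. p (p a b) c = p (p a c) b \<and> p (p a c) b = p (p b a) c"
  proof (intro allI)
    fix a b c :: 'a
    let ?X = "\<lambda>j :: nat. if j = 1 then a else if j = 2 then b else c"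
    show "p (p a b) c = p (p a c) b \<and> p (p a c) b = p (p b a) c"
      using swap[OF ex(1), of ?X] swap[OF ex(2), of ?X] by simp
  qed
qed

section \<open>The dual of the Lie-admissible operad\<close>

theorem proposition2p1:
  fixes scale :: "'k::field_char_0 \<Rightarrow> 'v::ab_group_add \<Rightarrow> 'v"
  assumes "vector_space scale"
  shows "dual_operad (lie_adm_relations :: 'k comb set) =
           binary_quadratic_operad assoc_abelian_relations
       \<and> bij_betw (algebra_product (orthogonal_relations (lie_adm_relations :: 'k comb set)))
           (algebra_structures scale (dual_operad lie_adm_relations))
           {p. bilinear_product scale p \<and> associative_product p \<and>
               (\<forall>a b c. p (p a b) c = p (p a c) b \<and> p (p a c) b = p (p b a) c)}
       \<and> (\<forall>p. bilinear_product scale p \<and> associative_product p \<longrightarrow>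
           ((\<forall>a b c. p (p a b) c = p (p a c) b \<and> p (p a c) b = p (p b a) c)
              \<longleftrightarrow> three_order_abelian p))"
proof (intro conjI)
  have orth: "orthogonal_relations lie_adm_relations = (assoc_abelian_relations :: 'k comb set)"
    by (simp add: orthogonal_lie_adm assoc_abelian_relations_eq)
  show "dual_operad (lie_adm_relations :: 'k comb set) = binary_quadratic_operad assoc_abelian_relations"
    by (simp add: dual_operad_def orth)
  have "(assoc_abelian_relations :: 'k comb set) \<subseteq> free_space 3"
    by (auto simp: assoc_abelian_relations_eq)
  from algebra_product_bij_betw[OF assms this]
  show "bij_betw (algebra_product (orthogonal_relations (lie_adm_relations :: 'k comb set)))
      (algebra_structures scale (dual_operad lie_adm_relations))
      {p. bilinear_product scale p \<and> associative_product p \<and>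
          (\<forall>a b c. p (p a b) c = p (p a c) b \<and> p (p a c) b = p (p b a) c)}"
    unfolding dual_operad_def orth assoc_abelian_action_zero_iff[OF assms] .
next
  show "\<forall>p. bilinear_product scale p \<and> associative_product p \<longrightarrow>
      ((\<forall>a b c. p (p a b) c = p (p a c) b \<and> p (p a c) b = p (p b a) c) \<longleftrightarrow> three_order_abelian p)"
    by (simp only: three_order_abelian_iff simp_thms)
qed

end
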